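(* Let $J=J(|x|)\geq0$ be a radial function in $L^1(\mathbb{R}^n)$ with $\|J\|_{L^1}=1$ such that $$\widehat{J}(\xi)=1-A|\xi|^\sigma(\ln(1/|\xi|))^\mu+o\left(|\xi|^\sigma(\ln(1/|\xi|))^\mu\right)\quad\text{as } \xi\to0,$$ where $\sigma\in(0,2]$, $\mu\in\mathbb{R}$, $A>0$. Let $u_0\in L^1(\mathbb{R}^n)$ with $\widehat{u}_0\in L^1(\mathbb{R}^n)$. Then $\mathcal{J}^ku_0\in L^p(\mathbb{R}^n)$ for all $k$ and any $1\leq p\leq\infty$, and, furthermore, there is a positive integer $N=N(n,J)$ such that $$\|\mathcal{J}^ku_0\|_{L^p}\leq C\left(\|u_0\|_{L^1}+\|\widehat{u}_0\|_{L^1}\right)(k(\ln k)^\mu)^{-\frac{n}{\sigma}(1-\frac{1}{p})}\quad\text{for all } k\geq N,$$ where $C>0$ is a constant depending only on $n,J$.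
   Context: $\mathcal{J}u=J\ast u$, i.e. $\mathcal{J}u(x)=\int_{\mathbb{R}^n}J(x-y)u(y)\,dy$, and $\mathcal{J}^k$ is its $k$-fold composition. The Fourier transform is $\widehat{f}(\xi)=\int_{\mathbb{R}^n}f(x)e^{-ix\cdot\xi}\,dx$. *)

theory Defs
  imports
    "HOL-Analysis.Analysis"
    "HOL-Library.Landau_Symbols"
    "HOL-Probability.Essential_Supremum"
begin

text \<open>Functions stand for their almost-everywhere classes: membership in \<open>Lp_space p\<close>
  and the value of \<open>Lp_norm p\<close> do not change under modification on a Lebesgue null set.\<close>

definition Lp_space :: "ereal \<Rightarrow> (real ^ 'n \<Rightarrow> 'b::real_normed_vector) set" where
  "Lp_space p = {f \<in> borel_measurable lebesgue.
     if p = \<infinity> then esssup lebesgue (\<lambda>x. ereal (norm (f x))) < \<infinity>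
     else integrable lebesgue (\<lambda>x. norm (f x) powr real_of_ereal p)}"

text \<open>The value is meaningful on \<open>Lp_space p\<close> only: the Bochner integral of a non-integrable
  function and \<open>real_of_ereal \<infinity>\<close> are both \<open>0\<close>.\<close>

definition Lp_norm :: "ereal \<Rightarrow> (real ^ 'n \<Rightarrow> 'b::real_normed_vector) \<Rightarrow> real" where
  "Lp_norm p f =
     (if p = \<infinity> then real_of_ereal (esssup lebesgue (\<lambda>x. ereal (norm (f x))))
      else (LINT x|lebesgue. norm (f x) powr real_of_ereal p) powr (1 / real_of_ereal p))"

lemma mem_Lp_space_1_iff:
  fixes f :: "real ^ 'n \<Rightarrow> 'b::{banach, second_countable_topology}"
  shows "f \<in> Lp_space 1 \<longleftrightarrow> integrable lebesgue f"
  unfolding Lp_space_def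
  by (auto simp: integrable_norm_iff dest: borel_measurable_integrable)

lemma Lp_norm_1_eq: "Lp_norm 1 f = (LINT x|lebesgue. norm (f x))"
  unfolding Lp_norm_def by simp

definition fourier :: "(real ^ 'n \<Rightarrow> complex) \<Rightarrow> real ^ 'n \<Rightarrow> complex" where
  "fourier f \<xi> = (LINT x|lebesgue. f x * exp (- \<i> * complex_of_real (x \<bullet> \<xi>)))"

text \<open>Where the integrand is not integrable (for \<open>J\<close> and \<open>u\<close> in $L^1$, at most on a null set)
  the convolution has the value \<open>0\<close>.\<close>

definition conv_op ::
    "(real ^ 'n \<Rightarrow> real) \<Rightarrow> (real ^ 'n \<Rightarrow> complex) \<Rightarrow> real ^ 'n \<Rightarrow> complex" where
  "conv_op J u x = (LINT y|lebesgue. J (x - y) *\<^sub>R u y)"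

definition radial :: "(real ^ 'n \<Rightarrow> real) \<Rightarrow> bool" where
  "radial f \<longleftrightarrow> (\<exists>g :: real \<Rightarrow> real. \<forall>x. f x = g (norm x))"

definition log_gauge :: "real \<Rightarrow> real \<Rightarrow> real ^ 'n \<Rightarrow> real" where
  "log_gauge \<sigma> \<mu> \<xi> = norm \<xi> powr \<sigma> * ln (1 / norm \<xi>) powr \<mu>"

end

theory Submission
  imports Defs "HOL-Probability.Probability" "HOL-Real_Asymp.Real_Asymp"
begin

text \<open>
  Write $\varphi = \widehat J$. The iterate \<open>(conv_op J ^^ k) u0\<close> has the Fourier transform
  $\varphi^k \widehat{u}_0$, and convolution with \<open>J\<close> contracts $L^1$. So it suffices to bound the
  supremum of the iterate by a constant times
  $(\|u_0\|_{L^1} + \|\widehat u_0\|_{L^1})\, X_k^{-n/\sigma}$ with $X_k = k (\ln k)^\mu$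
  (\<open>rate\<close> below): the bounds for the other exponents follow by interpolation with $L^1$
  (\<open>Lp_norm_interpolation\<close>), with a constant that does not depend on $p$.

  A function is bounded almost everywhere by $(2\pi)^{-n}$ times the $L^1$ norm of its Fourier
  transform (\<open>AE_bound_of_integrable_fourier\<close>), so everything reduces to
  $\int |\varphi|^k |\widehat u_0|$, which is split according to the size of $|\xi|$.

  Far from the origin $|\varphi| \le e^{-d} < 1$ (\<open>fourier_bounded_away_from_1\<close>), so this part
  is exponentially small and costs only $\|\widehat u_0\|_{L^1}$. The uniform gap comes from two
  facts. The Riemann-Lebesgue lemma makes $|\varphi|$ small near infinity, and the elementary
  inequality $1 - \cos 2t \le 4 (1 - \cos t)$ gives
  $1 - |\varphi(2\xi)| \le 4 (1 - |\varphi(\xi)|)$, which carries a gap at $2^m \xi$ back to $\xi$.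

  Near the origin the expansion gives
  $|\varphi|^k \le \exp(-\frac A2 k |\xi|^\sigma (\ln (1/|\xi|))^\mu)$. In the variable
  $\eta = X_k^{1/\sigma} \xi$ the logarithm is slowly varying, so at the price of half of the power of
  $|\eta|$ it may be replaced by a multiple of $\ln k$ (\<open>gauge_scaling\<close>). This leaves the integrable
  majorant $\exp(-c |\eta|^{\sigma/2})$, uniformly in \<open>k\<close>. Together with
  $|\widehat u_0| \le \|u_0\|_{L^1}$, the Jacobian of the change of variables is the rate
  $X_k^{-n/\sigma}$ (\<open>integral_symbol_power_bound\<close>).

  Both the Riemann-Lebesgue lemma and the inversion bound rest on the continuity of translations in
  $L^1$ (\<open>translation_gap_tendsto_0\<close>). The Fourier analysis is done for Borel functions and
  \<open>lborel\<close>, where Fubini's theorem applies to the product measure; Lebesgue measurable data are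
  replaced by Borel representatives.
\<close>

section \<open>Integration on Euclidean space\<close>

lemma lborel_affine_integral:
  fixes f :: "'a::euclidean_space \<Rightarrow> 'b::{banach, second_countable_topology}"
  assumes [measurable]: "f \<in> borel_measurable borel" and c: "c \<noteq> 0"
  shows lborel_affine_integrable_iff: "integrable lborel (\<lambda>x. f (t + c *\<^sub>R x)) \<longleftrightarrow> integrable lborel f"
    and lborel_affine_integral_eq:
      "(LINT x|lborel. f x) = \<bar>c\<bar> ^ DIM('a) *\<^sub>R (LINT x|lborel. f (t + c *\<^sub>R x))"
proof -
  have eq: "lborel = density (distr lborel borel (\<lambda>x. t + c *\<^sub>R x)) (\<lambda>_. ennreal (\<bar>c\<bar> ^ DIM('a)))"
    using lborel_affine[OF c, of t] by simp
  have c': "\<bar>c\<bar> ^ DIM('a) \<noteq> 0" using c by simp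
  show "integrable lborel (\<lambda>x. f (t + c *\<^sub>R x)) \<longleftrightarrow> integrable lborel f"
  proof -
    have "integrable lborel f \<longleftrightarrow> integrable lborel (\<lambda>x. \<bar>c\<bar> ^ DIM('a) *\<^sub>R f (t + c *\<^sub>R x))"
      by (subst eq, subst integrable_density) (auto simp: integrable_distr_eq)
    also have "\<dots> \<longleftrightarrow> integrable lborel (\<lambda>x. f (t + c *\<^sub>R x))"
    proof
      assume "integrable lborel (\<lambda>x. \<bar>c\<bar> ^ DIM('a) *\<^sub>R f (t + c *\<^sub>R x))"
      from integrable_scaleR_right[OF this, of "inverse (\<bar>c\<bar> ^ DIM('a))"]
      show "integrable lborel (\<lambda>x. f (t + c *\<^sub>R x))" using c' by simp
    next
      assume "integrable lborel (\<lambda>x. f (t + c *\<^sub>R x))"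
      then show "integrable lborel (\<lambda>x. \<bar>c\<bar> ^ DIM('a) *\<^sub>R f (t + c *\<^sub>R x))"
        by (rule integrable_scaleR_right)
    qed
    finally show ?thesis by simp
  qed
  show "(LINT x|lborel. f x) = \<bar>c\<bar> ^ DIM('a) *\<^sub>R (LINT x|lborel. f (t + c *\<^sub>R x))"
    by (subst eq, subst integral_density) (auto simp: integral_distr)
qed

text \<open>Serves to integrate the Gaussian, its product with a character, and the majorant of
  the stretched exponential, which all factor over the coordinates. It holds because
  \<open>lborel\<close> is the image of the product measure over the basis.\<close>
lemma lborel_prod_integral:
  fixes f :: "'a::euclidean_space \<Rightarrow> real \<Rightarrow> 'b::{real_normed_field, banach, second_countable_topology}"
  assumes f: "\<And>b. b \<in> Basis \<Longrightarrow> integrable lborel (f b)"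
  shows lborel_prod_integrable: "integrable lborel (\<lambda>x. \<Prod>b\<in>Basis. f b (x \<bullet> b))"
    and lborel_prod_integral_eq:
      "(LINT x|lborel. (\<Prod>b\<in>Basis. f b (x \<bullet> b))) = (\<Prod>b\<in>Basis. LINT t|lborel. f b t)"
proof -
  interpret product_sigma_finite "\<lambda>_::'a. lborel :: real measure"
    by standard
  have [measurable]: "f b \<in> borel_measurable borel" if "b \<in> Basis" for b
    using f[OF that] by (simp add: borel_measurable_integrable)
  have [simp]: "(\<Prod>b\<in>Basis. f b ((\<Sum>c\<in>Basis. x c *\<^sub>R c) \<bullet> b)) = (\<Prod>b\<in>Basis. f b (x b))" for x :: "'a \<Rightarrow> real"
    by (intro prod.cong refl) simp
  have m: "(\<lambda>x::'a. \<Prod>b\<in>Basis. f b (x \<bullet> b)) \<in> borel_measurable borel"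
    by measurable
  show "integrable lborel (\<lambda>x. \<Prod>b\<in>Basis. f b (x \<bullet> b))"
    using product_integrable_prod[OF finite_Basis, of f] f m
    by (subst lborel_eq, subst integrable_distr_eq) auto
  show "(LINT x|lborel. (\<Prod>b\<in>Basis. f b (x \<bullet> b))) = (\<Prod>b\<in>Basis. LINT t|lborel. f b t)"
    using product_integral_prod[OF finite_Basis, of f] f m
    by (subst lborel_eq, subst integral_distr) auto
qed

section \<open>Continuity of translations in $L^1$\<close>

definition translation_gap :: "('a::euclidean_space \<Rightarrow> 'b::{banach, second_countable_topology}) \<Rightarrow> 'a \<Rightarrow> real"
  where "translation_gap f h = (LINT x|lborel. norm (f (h + x) - f x))"

lemma integrable_translation:
  fixes f :: "'a::euclidean_space \<Rightarrow> 'b::{banach, second_countable_topology}"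
  assumes "integrable lborel f"
  shows "integrable lborel (\<lambda>x. f (h + x))"
  using lborel_affine_integrable_iff[of f 1 h] assms by (auto dest: borel_measurable_integrable)

lemma integral_translation:
  fixes f :: "'a::euclidean_space \<Rightarrow> 'b::{banach, second_countable_topology}"
  assumes "f \<in> borel_measurable borel"
  shows "(LINT x|lborel. f (h + x)) = (LINT x|lborel. f x)"
  using lborel_affine_integral_eq[of f 1 h] assms by simp

lemma translation_gap_triangle:
  fixes f g :: "'a::euclidean_space \<Rightarrow> 'b::{banach, second_countable_topology}"
  assumes f: "integrable lborel f" and g: "integrable lborel g"
  shows "translation_gap f h \<le> translation_gap g h + 2 * (LINT x|lborel. norm (f x - g x))"
proof -
  note [simp] = integrable_translation[OF f] integrable_translation[OF g] f g
  have m: "(\<lambda>x. norm (f x - g x)) \<in> borel_measurable borel"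
    using f[THEN borel_measurable_integrable] g[THEN borel_measurable_integrable] by simp
  have "translation_gap f h \<le> (LINT x|lborel. norm (g (h + x) - g x) +
          (norm (f (h + x) - g (h + x)) + norm (f x - g x)))"
    unfolding translation_gap_def
  proof (rule integral_mono)
    fix x
    have "f (h + x) - f x = (g (h + x) - g x) + ((f (h + x) - g (h + x)) - (f x - g x))" by simp
    then show "norm (f (h + x) - f x) \<le> norm (g (h + x) - g x) + (norm (f (h + x) - g (h + x)) + norm (f x - g x))"
      using norm_triangle_ineq[of "g (h + x) - g x" "(f (h + x) - g (h + x)) - (f x - g x)"]
        norm_triangle_ineq4[of "f (h + x) - g (h + x)" "f x - g x"] by simp
  qed auto
  also have "\<dots> = translation_gap g h + 2 * (LINT x|lborel. norm (f x - g x))"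
    using integral_translation[OF m, of h] by (simp add: translation_gap_def)
  finally show ?thesis .
qed

lemma translation_gap_add:
  fixes f g :: "'a::euclidean_space \<Rightarrow> 'b::{banach, second_countable_topology}"
  assumes f: "integrable lborel f" and g: "integrable lborel g"
  shows "translation_gap (\<lambda>x. f x + g x) h \<le> translation_gap f h + translation_gap g h"
proof -
  note [simp] = integrable_translation[OF f] integrable_translation[OF g] f g
  have "translation_gap (\<lambda>x. f x + g x) h \<le> (LINT x|lborel. norm (f (h + x) - f x) + norm (g (h + x) - g x))"
    unfolding translation_gap_def
    by (rule integral_mono) (auto simp: add_diff_add intro: norm_triangle_ineq)
  also have "\<dots> = translation_gap f h + translation_gap g h"
    by (simp add: translation_gap_def)
  finally show ?thesis .
qed

lemma translation_gap_nonneg: "0 \<le> translation_gap f h"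
  unfolding translation_gap_def by (rule integral_nonneg_AE) simp

lemma translation_gap_bounded:
  fixes f :: "'a::euclidean_space \<Rightarrow> 'b::{banach, second_countable_topology}"
  assumes f: "integrable lborel f"
  shows "translation_gap f h \<le> 2 * (LINT x|lborel. norm (f x))"
  using translation_gap_triangle[OF f, of "\<lambda>_. 0" h] by (simp add: translation_gap_def)

text \<open>For $A \subseteq U$ with \<open>U\<close> open and $U - A$ small, $|1_A(h + x) -
  1_A(x)|$ is at most $1_A(h + x) - 1_A(x) + 2 \cdot 1_A(x) (1 - 1_U(h + x)) + 2 \cdot 1_{U - A}(h
  + x)$. The first difference integrates to zero by translation invariance, the last term is
  small, and the middle term vanishes as $h \to 0$ by dominated convergence because
  \<open>U\<close> is open.\<close>
lemma translation_gap_indicator: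
  fixes A :: "'a::euclidean_space set" and c :: "'b::{banach, second_countable_topology}"
  assumes A: "A \<in> sets borel" and fin: "emeasure lborel A < \<infinity>"
  shows "(translation_gap (\<lambda>x. indicator A x *\<^sub>R c) \<longlongrightarrow> 0) (at 0)"
proof (rule tendstoI)
  fix e :: real assume e: "e > 0"
  \<comment> \<open>Two integrals below \<open>d\<close>, each with the factor \<open>2 * norm c\<close>, must stay below \<open>e\<close>.\<close>
  define d where "d = e / (4 * (norm c + 1))"
  have d: "d > 0" "norm c * (2 * d + 2 * d) < e"
    using e by (auto simp: d_def divide_simps add_nonneg_pos)
  have "A \<in> sets lebesgue" using A by (intro sets_completionI_sets) simp
  then obtain U where U: "open U" "A \<subseteq> U" "U - A \<in> lmeasurable" "emeasure lebesgue (U - A) < ennreal d"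
    using sets_lebesgue_outer_open d(1) by blast
  have [measurable]: "U \<in> sets borel" "A \<in> sets borel"
    using U(1) A by simp_all
  have em: "emeasure lborel (U - A) < ennreal d"
    using U(4) by (simp add: emeasure_completion)
  then have "emeasure lborel (U - A) < \<infinity>"
    using less_trans by fastforce
  then have UA: "integrable lborel (\<lambda>x. indicator (U - A) x :: real)"
    by (intro integrable_real_indicator) auto
  have "ennreal (measure lborel (U - A)) = emeasure lborel (U - A)"
    using \<open>emeasure lborel (U - A) < \<infinity>\<close> by (intro emeasure_eq_ennreal_measure[symmetric]) auto
  with em have "ennreal (measure lborel (U - A)) < ennreal d" by simp
  then have "measure lborel (U - A) < d" using d(1) by (simp add: ennreal_less_iff)
  then have UAd: "(LINT x|lborel. indicator (U - A) x) < d" by simp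
  have IA: "integrable lborel (\<lambda>x. indicator A x :: real)"
    using A fin by (intro integrable_real_indicator) auto
  \<comment> \<open>The limit at zero is tested along sequences, to which dominated convergence applies.\<close>
  have conv: "((\<lambda>h. LINT x|lborel. indicator A x * (1 - indicator U (h + x) :: real)) \<longlongrightarrow> 0) (at 0)"
    unfolding tendsto_at_iff_sequentially
  proof (intro allI impI)
    fix h :: "nat \<Rightarrow> 'a" assume "h \<longlonglongrightarrow> 0"
    have "(\<lambda>i. LINT x|lborel. indicator A x * (1 - indicator U (h i + x) :: real)) \<longlonglongrightarrow> (LINT x|(lborel :: 'a measure). 0)"
    proof (rule integral_dominated_convergence[where w="indicator A"])
      show "AE x in lborel. (\<lambda>i. indicator A x * (1 - indicator U (h i + x) :: real)) \<longlonglongrightarrow> 0"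
      proof (intro AE_I2)
        fix x
        have "(\<lambda>i. h i + x) \<longlonglongrightarrow> x" using tendsto_add[OF \<open>h \<longlonglongrightarrow> 0\<close> tendsto_const[of x]] by simp
        then have "\<forall>\<^sub>F i in sequentially. h i + x \<in> U" if "x \<in> A"
          using U that by (intro topological_tendstoD) auto
        then have "\<forall>\<^sub>F i in sequentially. indicator A x * (1 - indicator U (h i + x) :: real) = 0"
          by (cases "x \<in> A") (auto elim: eventually_mono)
        then show "(\<lambda>i. indicator A x * (1 - indicator U (h i + x) :: real)) \<longlonglongrightarrow> 0"
          by (rule tendsto_eventually)
      qed
    qed (use A U IA in \<open>auto split: split_indicator\<close>)
    then show "((\<lambda>h. LINT x|lborel. indicator A x * (1 - indicator U (h + x) :: real)) \<circ> h) \<longlonglongrightarrow> 0"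
      by (simp add: o_def)
  qed
  have "\<forall>\<^sub>F h in at 0. (LINT x|lborel. indicator A x * (1 - indicator U (h + x) :: real)) < d"
    using order_tendstoD(2)[OF conv d(1)] .
  then show "\<forall>\<^sub>F h in at 0. dist (translation_gap (\<lambda>x. indicator A x *\<^sub>R c) h) 0 < e"
  proof eventually_elim
    case (elim h)
    have i1: "integrable lborel (\<lambda>x. indicator A x * (1 - indicator U (h + x) :: real))"
      by (rule Bochner_Integration.integrable_bound[OF IA]) (use A U in \<open>auto split: split_indicator\<close>)
    note i2 = integrable_translation[OF IA, of h] integrable_translation[OF UA, of h]
    have "translation_gap (\<lambda>x. indicator A x *\<^sub>R c) h
        \<le> (LINT x|lborel. norm c * (((indicator A (h + x) - indicator A x) + 2 * (indicator A x * (1 - indicator U (h + x))))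
               + 2 * indicator (U - A) (h + x)))"
      unfolding translation_gap_def
    proof (rule integral_mono)
      show "norm (indicator A (h + x) *\<^sub>R c - indicator A x *\<^sub>R c) \<le> norm c * (((indicator A (h + x) - indicator A x)
          + 2 * (indicator A x * (1 - indicator U (h + x)))) + 2 * indicator (U - A) (h + x))" for x
        using U(2) by (cases "x \<in> A"; cases "h + x \<in> A"; cases "h + x \<in> U") auto
      show "integrable lborel (\<lambda>x. norm (indicator A (h + x) *\<^sub>R c - indicator A x *\<^sub>R c))"
        using IA integrable_translation[OF IA, of h] by auto
    qed (use IA i1 i2 in auto)
    also have "\<dots> = norm c * (2 * (LINT x|lborel. indicator A x * (1 - indicator U (h + x) :: real))
        + 2 * (LINT x|lborel. indicator (U - A) x))"
      using IA i1 i2 A U integral_translation[of "indicator A :: 'a \<Rightarrow> real" h]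
        integral_translation[of "indicator (U - A) :: 'a \<Rightarrow> real" h]
      by simp
    also have "\<dots> \<le> norm c * (2 * d + 2 * d)"
      using elim UAd by (intro mult_left_mono add_mono) auto
    also have "\<dots> < e" by (rule d)
    finally show ?case by (simp add: translation_gap_nonneg)
  qed
qed

text \<open>The functions with this property form a space that is closed under $L^1$ limits
  (\<open>translation_gap_triangle\<close>) and contains the indicators of sets of finite
  measure.\<close>
lemma translation_gap_tendsto_0:
  fixes f :: "'a::euclidean_space \<Rightarrow> 'b::{banach, second_countable_topology}"
  assumes "integrable lborel f"
  shows "(translation_gap f \<longlongrightarrow> 0) (at 0)"
  using assms
proof (induction rule: integrable_induct)
  case (base A c)
  then show ?case by (intro translation_gap_indicator) auto
next
  case (add f g)
  show ?case
  proof (rule tendsto_sandwich[of "\<lambda>_. 0"])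
    show "\<forall>\<^sub>F h in at 0. translation_gap (\<lambda>x. f x + g x) h \<le> translation_gap f h + translation_gap g h"
      using add by (simp add: translation_gap_add)
    show "((\<lambda>h. translation_gap f h + translation_gap g h) \<longlongrightarrow> 0) (at 0)"
      using tendsto_add[OF add(3,4)] add by (auto intro: tendsto_eq_intros)
  qed (auto simp: translation_gap_nonneg)
next
  case (lim f s)
  have conv: "(\<lambda>i. LINT x|lborel. norm (f x - s i x)) \<longlonglongrightarrow> (LINT x|(lborel :: 'a measure). 0)"
  proof (rule integral_dominated_convergence[where w="\<lambda>x. 3 * norm (f x)"])
    show "AE x in lborel. (\<lambda>i. norm (f x - s i x)) \<longlonglongrightarrow> 0"
      using lim(2) by (intro AE_I2) (auto intro!: tendsto_eq_intros)
    show "AE x in lborel. norm (norm (f x - s i x)) \<le> 3 * norm (f x)" for i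
    proof (intro AE_I2)
      fix x :: 'a
      have "norm (f x - s i x) \<le> norm (f x) + norm (s i x)" by (rule norm_triangle_ineq4)
      with lim(3)[of x i] show "norm (norm (f x - s i x)) \<le> 3 * norm (f x)" by simp
    qed
  qed (use lim(1,4) borel_measurable_integrable[OF lim(1)] borel_measurable_integrable[OF lim(4)] in \<open>auto\<close>)
  show ?case
  proof (rule tendstoI)
    fix e :: real assume e: "e > 0"
    then obtain i where i: "(LINT x|lborel. norm (f x - s i x)) < e / 4"
      using order_tendstoD(2)[OF conv, of "e/4"] by (auto simp: eventually_sequentially)
    have "\<forall>\<^sub>F h in at 0. translation_gap (s i) h < e / 2"
      using order_tendstoD(2)[OF lim(5), of "e/2"] e by auto
    then show "\<forall>\<^sub>F h in at 0. dist (translation_gap f h) 0 < e"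
    proof eventually_elim
      case (elim h)
      have "translation_gap f h \<le> translation_gap (s i) h + 2 * (LINT x|lborel. norm (f x - s i x))"
        by (rule translation_gap_triangle) (use lim in auto)
      with elim i show ?case by (simp add: translation_gap_nonneg)
    qed
  qed
qed

section \<open>Decay of the Fourier transform\<close>

abbreviation phase :: "real \<Rightarrow> complex" where
  "phase t \<equiv> exp (- \<i> * complex_of_real t)"

lemma norm_phase [simp]: "norm (phase t) = 1"
  by (simp add: norm_exp_eq_Re)

lemma phase_add: "phase (s + t) = phase s * phase t"
  unfolding exp_add[symmetric] by (simp add: ring_distribs)

lemma fourier_lborel:
  fixes f :: "real ^ 'n \<Rightarrow> complex"
  assumes "f \<in> borel_measurable borel"
  shows "fourier f \<xi> = (LINT x|lborel. f x * phase (x \<bullet> \<xi>))"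
  unfolding fourier_def by (rule integral_completion) (use assms in simp)

lemma integrable_mult_phase:
  fixes f :: "'a::euclidean_space \<Rightarrow> complex"
  assumes "integrable lborel f"
  shows "integrable lborel (\<lambda>x. f x * phase (x \<bullet> \<xi>))"
  by (rule Bochner_Integration.integrable_bound[OF assms])
     (use assms[THEN borel_measurable_integrable] in \<open>auto simp: norm_mult\<close>)

lemma norm_fourier_le:
  fixes f :: "real ^ 'n \<Rightarrow> complex"
  shows "norm (fourier f \<xi>) \<le> (LINT x|lebesgue. norm (f x))"
  using integral_norm_bound[of lebesgue "\<lambda>x. f x * phase (x \<bullet> \<xi>)"]
  by (simp add: fourier_def norm_mult)

lemma fourier_measurable [measurable]:
  fixes f :: "real ^ 'n \<Rightarrow> complex"
  assumes [measurable]: "f \<in> borel_measurable borel"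
  shows "fourier f \<in> borel_measurable borel"
proof -
  have "(\<lambda>\<xi>. LINT x|lborel. f x * phase (x \<bullet> \<xi>)) \<in> borel_measurable borel"
  proof (rule lborel.borel_measurable_lebesgue_integral)
    have "(\<lambda>z::(real^'n) \<times> (real^'n). phase (snd z \<bullet> fst z)) \<in> borel_measurable borel"
      by (intro borel_measurable_continuous_onI continuous_intros)
    then show "(\<lambda>(\<xi>, x). f x * phase (x \<bullet> \<xi>)) \<in> borel_measurable (borel \<Otimes>\<^sub>M lborel)"
      by (simp add: split_beta borel_prod[symmetric])
  qed
  then show ?thesis by (simp add: fourier_lborel[OF assms, abs_def])
qed

text \<open>The shift by $h = \pi \xi / |\xi|^2$ multiplies the Fourier transform at $\xi$ by
  $e^{i\pi} = -1$, so $-2 \widehat f(\xi)$ is the Fourier transform at $\xi$ of $f(h + \cdot) -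
  f$.\<close>
lemma fourier_le_translation_gap:
  fixes f :: "real ^ 'n \<Rightarrow> complex"
  assumes f: "integrable lborel f" and \<xi>: "\<xi> \<noteq> 0"
  shows "2 * norm (fourier f \<xi>) \<le> translation_gap f ((pi / (norm \<xi>)\<^sup>2) *\<^sub>R \<xi>)"
proof -
  define h where "h = (pi / (norm \<xi>)\<^sup>2) *\<^sub>R \<xi>"
  have h: "h \<bullet> \<xi> = pi" using \<xi> by (simp add: h_def dot_square_norm)
  have [measurable]: "f \<in> borel_measurable borel"
    using f[THEN borel_measurable_integrable] by simp
  note fh = integrable_translation[OF f, of h]
  have "fourier f \<xi> = (LINT x|lborel. f (h + x) * phase ((h + x) \<bullet> \<xi>))"
    unfolding fourier_lborel[OF \<open>f \<in> borel_measurable borel\<close>]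
    by (subst integral_translation[of _ h]) auto
  also have "\<dots> = (LINT x|lborel. - (f (h + x) * phase (x \<bullet> \<xi>)))"
  proof (intro Bochner_Integration.integral_cong refl)
    fix x
    have "phase pi = -1" using exp_pi_i by (simp add: exp_minus mult.commute)
    then show "f (h + x) * phase ((h + x) \<bullet> \<xi>) = - (f (h + x) * phase (x \<bullet> \<xi>))"
      unfolding inner_add_left h phase_add by simp
  qed
  finally have "- 2 * fourier f \<xi> = (LINT x|lborel. f (h + x) * phase (x \<bullet> \<xi>)) - fourier f \<xi>"
    by simp
  also have "\<dots> = (LINT x|lborel. (f (h + x) - f x) * phase (x \<bullet> \<xi>))"
    unfolding fourier_lborel[OF \<open>f \<in> borel_measurable borel\<close>] left_diff_distrib
    by (rule Bochner_Integration.integral_diff[symmetric]) (intro integrable_mult_phase f fh)+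
  finally have "norm (- 2 * fourier f \<xi>) \<le> (LINT x|lborel. norm ((f (h + x) - f x) * phase (x \<bullet> \<xi>)))"
    by (simp only: integral_norm_bound)
  then show ?thesis by (simp add: translation_gap_def norm_mult h_def)
qed

lemma riemann_lebesgue:
  fixes f :: "real ^ 'n \<Rightarrow> complex"
  assumes f: "integrable lborel f"
  shows "(fourier f \<longlongrightarrow> 0) at_infinity"
proof (rule tendstoI)
  fix e :: real assume e: "e > 0"
  have "\<forall>\<^sub>F h in at 0. translation_gap f h < e"
    using order_tendstoD(2)[OF translation_gap_tendsto_0[OF f] e] .
  then obtain d where d: "d > 0" "\<And>h. h \<noteq> 0 \<Longrightarrow> norm h < d \<Longrightarrow> translation_gap f h < e"
    by (auto simp: eventually_at dist_norm)
  have "dist (fourier f \<xi>) 0 < e" if "2 * pi / d \<le> norm \<xi>" for \<xi>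
  proof -
    have "0 < 2 * pi / d" using d(1) by simp
    with that have pos: "norm \<xi> > 0" by (rule less_le_trans[rotated])
    then have "\<xi> \<noteq> 0" by auto
    have "norm ((pi / (norm \<xi>)\<^sup>2) *\<^sub>R \<xi>) = pi / norm \<xi>"
      using \<open>\<xi> \<noteq> 0\<close> by (simp add: power2_eq_square)
    also have "2 * pi \<le> norm \<xi> * d" using that d(1) by (simp add: pos_divide_le_eq)
    then have "pi < d * norm \<xi>" using pi_gt_zero unfolding mult.commute[of d] by linarith
    then have "pi / norm \<xi> < d" using pos by (simp add: pos_divide_less_eq)
    finally have "translation_gap f ((pi / (norm \<xi>)\<^sup>2) *\<^sub>R \<xi>) < e"
      using \<open>\<xi> \<noteq> 0\<close> by (intro d(2)) auto
    with fourier_le_translation_gap[OF f \<open>\<xi> \<noteq> 0\<close>]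
    have "2 * norm (fourier f \<xi>) < e" by (rule le_less_trans)
    then have "norm (fourier f \<xi>) < e" using norm_ge_zero[of "fourier f \<xi>"] by linarith
    then show ?thesis by (simp add: dist_norm)
  qed
  then show "\<forall>\<^sub>F \<xi> in at_infinity. dist (fourier f \<xi>) 0 < e"
    unfolding eventually_at_infinity by blast
qed

text \<open>With $\theta$ the argument of $\varphi(\xi)$ one has $|\varphi(\xi)| = \int J(x)
  \cos(x \cdot \xi + \theta)\,dx$, and $|\varphi(2\xi)|$ is at least the same integral with the
  angle doubled. Since $J \ge 0$ has integral one, $1 - \cos 2t \le 4 (1 - \cos t)$ may be
  integrated against it.\<close>
lemma fourier_doubling:
  fixes J :: "real ^ 'n \<Rightarrow> real"
  assumes nn: "\<And>x. 0 \<le> J x" and J: "integrable lborel J" and J1: "(LINT x|lborel. J x) = 1"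
  defines "\<phi> \<equiv> fourier (\<lambda>x. complex_of_real (J x))"
  shows "1 - norm (\<phi> (2 *\<^sub>R \<xi>)) \<le> 4 * (1 - norm (\<phi> \<xi>))"
proof -
  have Jm: "J \<in> borel_measurable borel" using J[THEN borel_measurable_integrable] by simp
  then have cJm: "(\<lambda>x. complex_of_real (J x)) \<in> borel_measurable borel" by measurable
  have cJ: "integrable lborel (\<lambda>x. complex_of_real (J x))" using J by simp
  have icos: "integrable lborel (\<lambda>x. J x * cos (x \<bullet> \<eta> + s))" for \<eta> s
    by (rule Bochner_Integration.integrable_bound[OF J])
       (use Jm nn in \<open>auto simp: abs_mult intro!: mult_left_le\<close>)
  define \<theta> where "\<theta> = Arg (\<phi> \<xi>)"
  have re: "Re (\<phi> \<eta> * phase s) = (LINT x|lborel. J x * cos (x \<bullet> \<eta> + s))" for \<eta> s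
  proof -
    have "\<phi> \<eta> * phase s = (LINT x|lborel. of_real (J x) * phase (x \<bullet> \<eta>) * phase s)"
      unfolding \<phi>_def fourier_lborel[OF cJm] using integrable_mult_phase[OF cJ, of \<eta>] by simp
    also have "Re \<dots> = (LINT x|lborel. Re (of_real (J x) * phase (x \<bullet> \<eta>) * phase s))"
      by (rule integral_Re[symmetric]) (use integrable_mult_phase[OF cJ, of \<eta>] in simp)
    also have "\<dots> = (LINT x|lborel. J x * cos (x \<bullet> \<eta> + s))"
    proof (intro Bochner_Integration.integral_cong refl)
      fix x
      have "Re (phase (x \<bullet> \<eta> + s)) = cos (x \<bullet> \<eta> + s)"
        using cos_minus[of "x \<bullet> \<eta> + s"] by (simp add: Re_exp)
      then show "Re (of_real (J x) * phase (x \<bullet> \<eta>) * phase s) = J x * cos (x \<bullet> \<eta> + s)"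
        unfolding mult.assoc phase_add[symmetric] by (simp only: times_complex.sel) simp
    qed
    finally show ?thesis .
  qed
  have "\<phi> \<xi> = of_real (norm (\<phi> \<xi>)) * exp (\<i> * of_real \<theta>)"
    unfolding \<theta>_def by (metis Arg_eq norm_zero of_real_0 mult_zero_left)
  then have "\<phi> \<xi> * phase \<theta> = of_real (norm (\<phi> \<xi>))"
    by (metis exp_minus_inverse mult.assoc mult.right_neutral mult_minus_left)
  then have 1: "norm (\<phi> \<xi>) = (LINT x|lborel. J x * cos (x \<bullet> \<xi> + \<theta>))"
    using re[of \<xi> \<theta>] by simp
  have "(LINT x|lborel. J x * cos (x \<bullet> (2 *\<^sub>R \<xi>) + 2 * \<theta>)) \<le> norm (\<phi> (2 *\<^sub>R \<xi>) * phase (2 * \<theta>))"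
    unfolding re[symmetric] by (rule complex_Re_le_cmod)
  then have 2: "(LINT x|lborel. J x * cos (x \<bullet> (2 *\<^sub>R \<xi>) + 2 * \<theta>)) \<le> norm (\<phi> (2 *\<^sub>R \<xi>))"
    by (simp add: norm_mult del: exp_minus)
  have "(LINT x|lborel. J x - J x * cos (x \<bullet> (2 *\<^sub>R \<xi>) + 2 * \<theta>))
      \<le> (LINT x|lborel. 4 * (J x - J x * cos (x \<bullet> \<xi> + \<theta>)))"
  proof (rule integral_mono)
    fix x
    define t where "t = x \<bullet> \<xi> + \<theta>"
    have 2: "x \<bullet> (2 *\<^sub>R \<xi>) + 2 * \<theta> = 2 * t" by (simp add: t_def)
    have "1 - cos (2 * t) \<le> 4 * (1 - cos t)"
      using zero_le_power2[of "1 - cos t"] by (simp add: cos_double_cos power2_diff)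
    then have "J x * (1 - cos (2 * t)) \<le> J x * (4 * (1 - cos t))"
      by (rule mult_left_mono) (rule nn)
    then show "J x - J x * cos (x \<bullet> (2 *\<^sub>R \<xi>) + 2 * \<theta>) \<le> 4 * (J x - J x * cos (x \<bullet> \<xi> + \<theta>))"
      unfolding 2 t_def[symmetric] by (simp add: algebra_simps)
  qed (intro Bochner_Integration.integrable_diff integrable_mult_right J icos)+
  then have "1 - (LINT x|lborel. J x * cos (x \<bullet> (2 *\<^sub>R \<xi>) + 2 * \<theta>)) \<le> 4 * (1 - norm (\<phi> \<xi>))"
    unfolding integral_mult_right_zero Bochner_Integration.integral_diff[OF J icos] J1 1 .
  then show ?thesis by (rule order_trans[rotated]) (rule diff_left_mono[OF 2])
qed

text \<open>If $2^m r$ exceeds the radius outside of which the Riemann-Lebesgue lemma gives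
  $|\varphi| < 1/2$, then \<open>m\<close> doublings yield $1 - |\varphi(\xi)| \ge \frac12 4^{-m}$
  for all $|\xi| \ge r$.\<close>
lemma fourier_bounded_away_from_1:
  fixes J :: "real ^ 'n \<Rightarrow> real"
  assumes nn: "\<And>x. 0 \<le> J x" and J: "integrable lborel J" and J1: "(LINT x|lborel. J x) = 1"
    and r: "r > 0"
  shows "\<exists>d>0. \<forall>\<xi>. norm \<xi> \<ge> r \<longrightarrow> norm (fourier (\<lambda>x. complex_of_real (J x)) \<xi>) \<le> exp (- d)"
proof -
  define \<phi> where "\<phi> = fourier (\<lambda>x. complex_of_real (J x))"
  have "(\<phi> \<longlongrightarrow> 0) at_infinity"
    unfolding \<phi>_def by (rule riemann_lebesgue) (use J in simp)
  then have "\<forall>\<^sub>F \<xi> in at_infinity. norm (\<phi> \<xi>) < 1/2"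
    using tendstoD[of \<phi> 0 at_infinity "1/2"] by simp
  then obtain R where R: "\<And>\<xi>. norm \<xi> \<ge> R \<Longrightarrow> norm (\<phi> \<xi>) < 1/2"
    by (auto simp: eventually_at_infinity)
  obtain m :: nat where m: "R / r < 2 ^ m"
    using real_arch_pow[of 2 "R / r"] by auto
  have iter: "1 - norm (\<phi> (2 ^ j *\<^sub>R \<xi>)) \<le> 4 ^ j * (1 - norm (\<phi> \<xi>))" for j \<xi>
  proof (induction j)
    case (Suc j)
    have "1 - norm (\<phi> (2 ^ Suc j *\<^sub>R \<xi>)) \<le> 4 * (1 - norm (\<phi> (2 ^ j *\<^sub>R \<xi>)))"
      using fourier_doubling[OF nn J J1, of "2 ^ j *\<^sub>R \<xi>"] by (simp add: \<phi>_def)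
    with Suc show ?case by simp
  qed simp
  define d where "d = (1/2::real) / 4 ^ m"
  have "norm (\<phi> \<xi>) \<le> exp (- d)" if "norm \<xi> \<ge> r" for \<xi>
  proof -
    have "R \<le> 2 ^ m * r" using m r by (simp add: field_simps)
    also have "\<dots> \<le> 2 ^ m * norm \<xi>" using that by simp
    finally have "norm (\<phi> (2 ^ m *\<^sub>R \<xi>)) < 1/2" by (intro R) simp
    with iter[of m \<xi>] have "1/2 \<le> 4 ^ m * (1 - norm (\<phi> \<xi>))" by linarith
    then have "norm (\<phi> \<xi>) \<le> 1 - d" by (simp add: d_def field_simps)
    also have "\<dots> \<le> exp (- d)" using exp_ge_add_one_self[of "- d"] by simp
    finally show ?thesis .
  qed
  then show ?thesis by (intro exI[of _ d]) (auto simp: \<phi>_def d_def)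
qed

section \<open>The Gaussian and the inversion bound\<close>

text \<open>The standard normal density is its own Fourier transform up to a constant; in higher
  dimension this holds coordinatewise, which makes \<open>gauss_density\<close> a mollifier whose
  Fourier transform is known.\<close>
lemma std_normal_fourier:
  "(LINT t|lborel. complex_of_real (std_normal_density t) * phase (t * s))
     = complex_of_real (sqrt (2 * pi) * std_normal_density s)"
proof -
  have "(LINT t|lborel. complex_of_real (std_normal_density t) * phase (t * s))
      = (LINT t|lborel. std_normal_density t *\<^sub>R iexp (- s * t))"
    by (intro Bochner_Integration.integral_cong refl) (simp add: scaleR_conv_of_real mult.commute)
  also have "\<dots> = char std_normal_distribution (- s)"
    unfolding char_def by (rule integral_density[symmetric]) auto
  also have "\<dots> = complex_of_real (sqrt (2 * pi) * std_normal_density s)"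
    unfolding char_std_normal_distribution by (simp add: std_normal_density_def)
  finally show ?thesis .
qed

definition gauss_density :: "'a::euclidean_space \<Rightarrow> real" where
  "gauss_density x = (\<Prod>b\<in>Basis. std_normal_density (x \<bullet> b))"

lemma gauss_density_nonneg: "0 \<le> gauss_density x"
  unfolding gauss_density_def by (intro prod_nonneg) simp

lemma gauss_density_le: "gauss_density (x :: 'a::euclidean_space) \<le> (1 / sqrt (2 * pi)) ^ DIM('a)"
proof -
  have "gauss_density x \<le> (\<Prod>b\<in>(Basis :: 'a set). 1 / sqrt (2 * pi))"
    unfolding gauss_density_def by (intro prod_mono) (auto simp: std_normal_density_def divide_right_mono)
  then show ?thesis by simp
qed

lemma gauss_density_integrable: "integrable lborel (gauss_density :: 'a::euclidean_space \<Rightarrow> real)"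
  unfolding gauss_density_def[abs_def] by (intro lborel_prod_integrable) simp

lemma gauss_density_measurable [measurable]: "(gauss_density :: 'a::euclidean_space \<Rightarrow> real) \<in> borel_measurable borel"
  using gauss_density_integrable[THEN borel_measurable_integrable] by simp

lemma gauss_density_integral: "(LINT x|lborel. gauss_density (x :: 'a::euclidean_space)) = 1"
proof -
  have "(LINT x|lborel. gauss_density (x :: 'a)) = (\<Prod>b\<in>(Basis :: 'a set). LINT t|lborel. std_normal_density t)"
    unfolding gauss_density_def by (intro lborel_prod_integral_eq) simp
  then show ?thesis by simp
qed

lemma gauss_density_fourier:
  fixes y :: "'a::euclidean_space"
  shows "(LINT x|lborel. complex_of_real (gauss_density x) * phase (x \<bullet> y))
     = complex_of_real (sqrt (2 * pi) ^ DIM('a) * gauss_density y)"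
proof -
  have ph: "phase (x \<bullet> y) = (\<Prod>b\<in>Basis. phase ((x \<bullet> b) * (y \<bullet> b)))" for x :: 'a
    by (subst euclidean_inner) (simp add: exp_sum sum_distrib_left sum_negf[symmetric])
  have "(LINT x|lborel. complex_of_real (gauss_density x) * phase (x \<bullet> y))
     = (LINT x|lborel. (\<Prod>b\<in>Basis. complex_of_real (std_normal_density (x \<bullet> b)) * phase ((x \<bullet> b) * (y \<bullet> b))))"
    unfolding ph gauss_density_def by (simp add: prod.distrib)
  also have "\<dots> = (\<Prod>b\<in>Basis. LINT t|lborel. complex_of_real (std_normal_density t) * phase (t * (y \<bullet> b)))"
  proof (rule lborel_prod_integral_eq)
    fix b :: 'a
    show "integrable lborel (\<lambda>t. complex_of_real (std_normal_density t) * phase (t * (y \<bullet> b)))"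
      using integrable_mult_phase[of "\<lambda>t::real. complex_of_real (std_normal_density t)" "y \<bullet> b"] by simp
  qed
  also have "\<dots> = complex_of_real (sqrt (2 * pi) ^ DIM('a) * gauss_density y)"
    unfolding std_normal_fourier gauss_density_def by (simp add: prod.distrib)
  finally show ?thesis .
qed

text \<open>Insert the Gaussian as a multiple of its own Fourier transform and exchange the
  integrals: the average becomes a Gaussian-weighted integral of $\widehat f(\eta / t)$ with a
  unimodular factor. The factor $t^{-n}$ from the inner substitution cancels the Jacobian of the
  outer one, so that the bound does not depend on \<open>t\<close>. One factor $(2\pi)^{-n/2}$
  comes from the Gaussian's Fourier transform and the other one from its maximum.\<close>
lemma mollification_bound:
  fixes f :: "real ^ 'n \<Rightarrow> complex"
  assumes f: "integrable lborel f" and F: "integrable lborel (fourier f)" and t: "t > 0"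
  shows "norm (LINT y|lborel. gauss_density y *\<^sub>R f (x + t *\<^sub>R y))
     \<le> (LINT \<xi>|lborel. norm (fourier f \<xi>)) / (2 * pi) ^ CARD('n)"
proof -
  define n where "n = CARD('n)"
  let ?c = "1 / sqrt (2 * pi) ^ n :: real"
  let ?G = "gauss_density :: real ^ 'n \<Rightarrow> real"
  have fm [measurable]: "f \<in> borel_measurable borel"
    using f[THEN borel_measurable_integrable] by simp
  have c0: "?c > 0" by simp
  have ft: "integrable lborel (\<lambda>y. f (x + t *\<^sub>R y))"
    using lborel_affine_integrable_iff[OF fm, of t x] f t by simp
  have G: "complex_of_real (?G y) = ?c * (LINT \<eta>|lborel. complex_of_real (?G \<eta>) * phase (\<eta> \<bullet> y))" for y
    unfolding gauss_density_fourier by (simp add: n_def)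
  have ph: "(\<lambda>z::(real^'n) \<times> (real^'n). phase (snd z \<bullet> fst z)) \<in> borel_measurable (lborel \<Otimes>\<^sub>M lborel)"
  proof -
    have "(\<lambda>z::(real^'n) \<times> (real^'n). phase (snd z \<bullet> fst z)) \<in> borel_measurable borel"
      by (intro borel_measurable_continuous_onI continuous_intros)
    then show ?thesis by (simp add: borel_prod[symmetric])
  qed
  have prodint: "integrable (lborel \<Otimes>\<^sub>M lborel)
      (\<lambda>(y, \<eta>). (f (x + t *\<^sub>R y) * complex_of_real (?G \<eta>)) * phase (\<eta> \<bullet> y))"
  proof (rule lborel_pair.Fubini_integrable)
    show "(\<lambda>(y, \<eta>). (f (x + t *\<^sub>R y) * complex_of_real (?G \<eta>)) * phase (\<eta> \<bullet> y)) \<in> borel_measurable (lborel \<Otimes>\<^sub>M lborel)"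
      unfolding split_beta by (intro borel_measurable_times ph) measurable
    show "integrable lborel (\<lambda>y. LINT \<eta>|lborel. norm (case (y, \<eta>) of (y, \<eta>) \<Rightarrow> (f (x + t *\<^sub>R y) * complex_of_real (?G \<eta>)) * phase (\<eta> \<bullet> y)))"
      using ft by (simp add: norm_mult gauss_density_nonneg gauss_density_integral)
    show "AE y in lborel. integrable lborel (\<lambda>\<eta>. case (y, \<eta>) of (y, \<eta>) \<Rightarrow> (f (x + t *\<^sub>R y) * complex_of_real (?G \<eta>)) * phase (\<eta> \<bullet> y))"
      unfolding prod.case
      by (intro AE_I2 integrable_mult_phase integrable_mult_right integrable_of_real gauss_density_integrable)
  qed
  have inner: "(LINT y|lborel. f (x + t *\<^sub>R y) * phase (\<eta> \<bullet> y))
      = complex_of_real (1 / t ^ n) * (phase (- (x \<bullet> \<eta>) / t) * fourier f ((1 / t) *\<^sub>R \<eta>))" for \<eta>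
  proof -
    have "fourier f ((1 / t) *\<^sub>R \<eta>) = (LINT z|lborel. f z * phase (z \<bullet> ((1 / t) *\<^sub>R \<eta>)))"
      by (rule fourier_lborel[OF fm])
    also have "\<dots> = t ^ n *\<^sub>R (LINT y|lborel. f (x + t *\<^sub>R y) * phase ((x + t *\<^sub>R y) \<bullet> ((1 / t) *\<^sub>R \<eta>)))"
      using t by (subst lborel_affine_integral_eq[of _ t x]) (auto simp: n_def)
    also have "(LINT y|lborel. f (x + t *\<^sub>R y) * phase ((x + t *\<^sub>R y) \<bullet> ((1 / t) *\<^sub>R \<eta>)))
       = (LINT y|lborel. phase (x \<bullet> \<eta> / t) * (f (x + t *\<^sub>R y) * phase (\<eta> \<bullet> y)))"
    proof (intro Bochner_Integration.integral_cong refl)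
      fix y
      have "(x + t *\<^sub>R y) \<bullet> ((1 / t) *\<^sub>R \<eta>) = x \<bullet> \<eta> / t + \<eta> \<bullet> y"
        using t by (simp add: inner_add_left inner_add_right inner_commute add_divide_distrib)
      then show "f (x + t *\<^sub>R y) * phase ((x + t *\<^sub>R y) \<bullet> ((1 / t) *\<^sub>R \<eta>)) = phase (x \<bullet> \<eta> / t) * (f (x + t *\<^sub>R y) * phase (\<eta> \<bullet> y))"
        by (simp only: phase_add) (simp only: mult_ac)
    qed
    also have "\<dots> = phase (x \<bullet> \<eta> / t) * (LINT y|lborel. f (x + t *\<^sub>R y) * phase (\<eta> \<bullet> y))"
      by (rule integral_mult_right_zero)
    finally have "phase (- (x \<bullet> \<eta>) / t) * fourier f ((1 / t) *\<^sub>R \<eta>) =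
       t ^ n *\<^sub>R ((phase (- (x \<bullet> \<eta>) / t) * phase (x \<bullet> \<eta> / t)) * (LINT y|lborel. f (x + t *\<^sub>R y) * phase (\<eta> \<bullet> y)))"
      by simp
    also have "phase (- (x \<bullet> \<eta>) / t) * phase (x \<bullet> \<eta> / t) = 1"
      unfolding phase_add[symmetric] by simp
    finally show ?thesis using t by (simp add: scaleR_conv_of_real)
  qed
  have Fs: "integrable lborel (\<lambda>\<eta>. fourier f ((1 / t) *\<^sub>R \<eta>))"
    using lborel_affine_integrable_iff[of "fourier f" "1 / t" 0] F t by simp
  have "(LINT y|lborel. ?G y *\<^sub>R f (x + t *\<^sub>R y))
      = (LINT y|lborel. ?c * (LINT \<eta>|lborel. (f (x + t *\<^sub>R y) * complex_of_real (?G \<eta>)) * phase (\<eta> \<bullet> y)))"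
  proof (intro Bochner_Integration.integral_cong refl)
    fix y
    have "?G y *\<^sub>R f (x + t *\<^sub>R y) = f (x + t *\<^sub>R y) * complex_of_real (?G y)"
      by (simp add: scaleR_conv_of_real)
    also have "\<dots> = ?c * (f (x + t *\<^sub>R y) * (LINT \<eta>|lborel. complex_of_real (?G \<eta>) * phase (\<eta> \<bullet> y)))"
      unfolding G[of y] by (simp only: mult_ac)
    also have "f (x + t *\<^sub>R y) * (LINT \<eta>|lborel. complex_of_real (?G \<eta>) * phase (\<eta> \<bullet> y))
      = (LINT \<eta>|lborel. (f (x + t *\<^sub>R y) * complex_of_real (?G \<eta>)) * phase (\<eta> \<bullet> y))"
      unfolding mult.assoc by (rule integral_mult_right_zero[symmetric])
    finally show "?G y *\<^sub>R f (x + t *\<^sub>R y)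
      = ?c * (LINT \<eta>|lborel. (f (x + t *\<^sub>R y) * complex_of_real (?G \<eta>)) * phase (\<eta> \<bullet> y))" .
  qed
  also have "\<dots> = ?c * (LINT \<eta>|lborel. LINT y|lborel. (f (x + t *\<^sub>R y) * complex_of_real (?G \<eta>)) * phase (\<eta> \<bullet> y))"
    unfolding integral_mult_right_zero lborel_pair.Fubini_integral[OF prodint] ..
  also have "\<dots> = ?c * (LINT \<eta>|lborel. complex_of_real (?G \<eta>) * (complex_of_real (1 / t ^ n) * (phase (- (x \<bullet> \<eta>) / t) * fourier f ((1 / t) *\<^sub>R \<eta>))))"
  proof -
    have "(LINT y|lborel. (f (x + t *\<^sub>R y) * complex_of_real (?G \<eta>)) * phase (\<eta> \<bullet> y))
      = complex_of_real (?G \<eta>) * (LINT y|lborel. f (x + t *\<^sub>R y) * phase (\<eta> \<bullet> y))" for \<eta>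
      unfolding integral_mult_right_zero[symmetric] by (simp only: mult_ac)
    then show ?thesis by (simp only: inner)
  qed
  finally have "norm (LINT y|lborel. ?G y *\<^sub>R f (x + t *\<^sub>R y))
      = ?c * norm (LINT \<eta>|lborel. complex_of_real (?G \<eta>) * (complex_of_real (1 / t ^ n) * (phase (- (x \<bullet> \<eta>) / t) * fourier f ((1 / t) *\<^sub>R \<eta>))))"
    using c0 by (simp add: norm_mult norm_divide norm_power)
  also have "\<dots> \<le> ?c * (LINT \<eta>|lborel. ?G \<eta> * (1 / t ^ n * norm (fourier f ((1 / t) *\<^sub>R \<eta>))))"
  proof (rule mult_left_mono)
    have "norm (complex_of_real (?G \<eta>) * (complex_of_real (1 / t ^ n) * (phase (- (x \<bullet> \<eta>) / t) * fourier f ((1 / t) *\<^sub>R \<eta>))))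
      = ?G \<eta> * (1 / t ^ n * norm (fourier f ((1 / t) *\<^sub>R \<eta>)))" for \<eta>
      using t by (simp only: norm_mult norm_phase norm_of_real) (simp add: gauss_density_nonneg)
    then show "norm (LINT \<eta>|lborel. complex_of_real (?G \<eta>) * (complex_of_real (1 / t ^ n) * (phase (- (x \<bullet> \<eta>) / t) * fourier f ((1 / t) *\<^sub>R \<eta>))))
      \<le> (LINT \<eta>|lborel. ?G \<eta> * (1 / t ^ n * norm (fourier f ((1 / t) *\<^sub>R \<eta>))))"
      by (metis (mono_tags, lifting) integral_norm_bound Bochner_Integration.integral_cong)
  qed (use c0 in simp)
  also have "\<dots> \<le> ?c * (LINT \<eta>|lborel. ?c * (1 / t ^ n * norm (fourier f ((1 / t) *\<^sub>R \<eta>))))"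
  proof (intro mult_left_mono integral_mono)
    have le: "?G \<eta> \<le> ?c" for \<eta> using gauss_density_le[of \<eta>] by (simp add: n_def power_one_over)
    show "?G \<eta> * (1 / t ^ n * norm (fourier f ((1 / t) *\<^sub>R \<eta>))) \<le> ?c * (1 / t ^ n * norm (fourier f ((1 / t) *\<^sub>R \<eta>)))" for \<eta>
      using t by (intro mult_right_mono le) auto
    show i: "integrable lborel (\<lambda>\<eta>. ?c * (1 / t ^ n * norm (fourier f ((1 / t) *\<^sub>R \<eta>))))"
      using Fs by (intro integrable_mult_right integrable_norm)
    show "integrable lborel (\<lambda>\<eta>. ?G \<eta> * (1 / t ^ n * norm (fourier f ((1 / t) *\<^sub>R \<eta>))))"
    proof (rule Bochner_Integration.integrable_bound[OF i])
      show "AE \<eta> in lborel. norm (?G \<eta> * (1 / t ^ n * norm (fourier f ((1 / t) *\<^sub>R \<eta>)))) \<le> norm (?c * (1 / t ^ n * norm (fourier f ((1 / t) *\<^sub>R \<eta>))))"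
        unfolding norm_mult using le t
        by (intro AE_I2 mult_right_mono) (auto simp: abs_of_nonneg[OF gauss_density_nonneg])
    qed measurable
  qed (use c0 in simp)
  also have "\<dots> = ?c * ?c * ((1 / t ^ n) * (LINT \<eta>|lborel. norm (fourier f ((1 / t) *\<^sub>R \<eta>))))"
    by (simp only: integral_mult_right_zero mult.assoc)
  also have "(1 / t ^ n) * (LINT \<eta>|lborel. norm (fourier f ((1 / t) *\<^sub>R \<eta>))) = (LINT \<xi>|lborel. norm (fourier f \<xi>))"
    using t lborel_affine_integral_eq[of "\<lambda>\<xi>. norm (fourier f \<xi>)" "1 / t" 0]
    by (simp add: n_def power_one_over)
  also have "?c * ?c = 1 / (2 * pi) ^ n"
    using power_mult_distrib[of "sqrt (2 * pi)" "sqrt (2 * pi)" n] by simp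
  finally show ?thesis by (simp add: n_def)
qed

lemma translation_gap_measurable [measurable]:
  fixes f :: "'a::euclidean_space \<Rightarrow> 'b::{banach, second_countable_topology}"
  assumes [measurable]: "f \<in> borel_measurable borel"
  shows "translation_gap f \<in> borel_measurable borel"
  unfolding translation_gap_def[abs_def]
  by (rule lborel.borel_measurable_lebesgue_integral) measurable

text \<open>Dominated convergence: translation gaps are bounded by twice the norm, and they tend
  to zero with the shift.\<close>
lemma gaussian_average_translation_gap:
  fixes f :: "'a::euclidean_space \<Rightarrow> 'b::{banach, second_countable_topology}"
  assumes f: "integrable lborel f"
  shows "(\<lambda>j. LINT y|lborel. gauss_density y * translation_gap f ((1 / real (Suc j)) *\<^sub>R y)) \<longlonglongrightarrow> 0"
proof -
  have fm [measurable]: "f \<in> borel_measurable borel"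
    using f[THEN borel_measurable_integrable] by simp
  let ?M = "2 * (LINT x|lborel. norm (f x))"
  have gap0: "translation_gap f 0 = 0" by (simp add: translation_gap_def)
  have cont: "isCont (translation_gap f) 0"
    using translation_gap_tendsto_0[OF f] gap0 by (simp add: isCont_def)
  have "(\<lambda>j. LINT y|lborel. gauss_density y * translation_gap f ((1 / real (Suc j)) *\<^sub>R y)) \<longlonglongrightarrow> (LINT y|(lborel :: 'a measure). 0)"
  proof (rule integral_dominated_convergence[where w="\<lambda>y. gauss_density y * ?M"])
    show "AE y in lborel. (\<lambda>j. gauss_density y * translation_gap f ((1 / real (Suc j)) *\<^sub>R y)) \<longlonglongrightarrow> 0"
    proof (intro AE_I2)
      fix y :: 'a
      have "(\<lambda>j. (1 / real (Suc j)) *\<^sub>R y) \<longlonglongrightarrow> 0 *\<^sub>R y"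
        by (intro tendsto_scaleR tendsto_const LIMSEQ_Suc lim_1_over_n)
      then have "(\<lambda>j. (1 / real (Suc j)) *\<^sub>R y) \<longlonglongrightarrow> 0" by simp
      from isCont_tendsto_compose[OF cont this]
      have "(\<lambda>j. translation_gap f ((1 / real (Suc j)) *\<^sub>R y)) \<longlonglongrightarrow> 0"
        unfolding gap0 .
      from tendsto_mult_left[OF this, of "gauss_density y"]
      show "(\<lambda>j. gauss_density y * translation_gap f ((1 / real (Suc j)) *\<^sub>R y)) \<longlonglongrightarrow> 0" by simp
    qed
    show "AE y in lborel. norm (gauss_density y * translation_gap f ((1 / real (Suc j)) *\<^sub>R y)) \<le> gauss_density y * ?M" for j
      using translation_gap_bounded[OF f]
      by (intro AE_I2) (simp add: abs_mult abs_of_nonneg gauss_density_nonneg translation_gap_nonneg mult_left_mono)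
    show "integrable lborel (\<lambda>y::'a. gauss_density y * ?M)"
      by (intro integrable_mult_left gauss_density_integrable)
  qed measurable
  then show ?thesis by simp
qed

text \<open>Let \<open>B\<close> be the claimed bound and $f_t$ the Gaussian average of
  \<open>f\<close> at scale \<open>t\<close>. Since $|f_t| \le B$ everywhere, $\max(0, |f| - B)
  \le |f - f_t|$, and the integral of the right-hand side is at most the average translation gap,
  which vanishes as $t \to 0$.\<close>
lemma AE_bound_of_integrable_fourier:
  fixes f :: "real ^ 'n \<Rightarrow> complex"
  assumes f: "integrable lborel f" and F: "integrable lborel (fourier f)"
  shows "AE x in lborel. norm (f x) \<le> (LINT \<xi>|lborel. norm (fourier f \<xi>)) / (2 * pi) ^ CARD('n)"
proof -
  define B where "B = (LINT \<xi>|lborel. norm (fourier f \<xi>)) / (2 * pi) ^ CARD('n)"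
  let ?G = "gauss_density :: real ^ 'n \<Rightarrow> real"
  have B0: "B \<ge> 0" by (simp add: B_def)
  have fm [measurable]: "f \<in> borel_measurable borel"
    using f[THEN borel_measurable_integrable] by simp
  let ?e = "\<lambda>x. max 0 (norm (f x) - B)"
  have ei: "integrable lborel ?e"
    by (rule Bochner_Integration.integrable_bound[OF f]) (use B0 in auto)
  have step: "(LINT x|lborel. ?e x) \<le> (LINT y|lborel. ?G y * translation_gap f (t *\<^sub>R y))" if t: "t > 0" for t
  proof -
    let ?D = "\<lambda>y x. ?G y * norm (f (t *\<^sub>R y + x) - f x)"
    have prodint: "integrable (lborel \<Otimes>\<^sub>M lborel) (\<lambda>(y, x). ?D y x)"
    proof (rule lborel_pair.Fubini_integrable)
      show "(\<lambda>(y, x). ?D y x) \<in> borel_measurable (lborel \<Otimes>\<^sub>M lborel)"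
        by measurable
      show "AE y in lborel. integrable lborel (\<lambda>x. case (y, x) of (y, x) \<Rightarrow> ?D y x)"
        unfolding prod.case
        by (intro AE_I2 integrable_mult_right integrable_norm Bochner_Integration.integrable_diff integrable_translation f)
      have "integrable lborel (\<lambda>y. ?G y * translation_gap f (t *\<^sub>R y))"
      proof (rule Bochner_Integration.integrable_bound)
        show "integrable lborel (\<lambda>y. ?G y * (2 * (LINT x|lborel. norm (f x))))"
          by (intro integrable_mult_left gauss_density_integrable)
        show "AE y in lborel. norm (?G y * translation_gap f (t *\<^sub>R y)) \<le> norm (?G y * (2 * (LINT x|lborel. norm (f x))))"
          using translation_gap_bounded[OF f]
          by (intro AE_I2) (simp add: abs_mult abs_of_nonneg gauss_density_nonneg translation_gap_nonneg mult_left_mono)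
      qed measurable
      then show "integrable lborel (\<lambda>y. LINT x|lborel. norm (case (y, x) of (y, x) \<Rightarrow> ?D y x))"
        by (simp add: translation_gap_def abs_mult abs_of_nonneg gauss_density_nonneg)
    qed
    have "?e x \<le> (LINT y|lborel. ?D y x)" for x
    proof -
      have i1: "integrable lborel (\<lambda>y. ?G y *\<^sub>R f (x + t *\<^sub>R y))"
      proof (rule Bochner_Integration.integrable_bound)
        show "integrable lborel (\<lambda>y. (1 / sqrt (2 * pi)) ^ CARD('n) *\<^sub>R f (x + t *\<^sub>R y))"
          using lborel_affine_integrable_iff[OF fm, of t x] f t by (intro integrable_scaleR_right) simp
        show "AE y in lborel. norm (?G y *\<^sub>R f (x + t *\<^sub>R y)) \<le> norm ((1 / sqrt (2 * pi)) ^ CARD('n) *\<^sub>R f (x + t *\<^sub>R y))"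
          using gauss_density_le[where 'a="real^'n"]
          by (intro AE_I2) (auto simp: abs_of_nonneg gauss_density_nonneg intro!: mult_right_mono)
      qed measurable
      have i2: "integrable lborel (\<lambda>y. ?G y *\<^sub>R f x)"
        by (intro integrable_scaleR_left gauss_density_integrable)
      have "f x = (LINT y|lborel. ?G y *\<^sub>R f x)"
        by (subst integral_scaleR_left) (simp_all add: gauss_density_integrable gauss_density_integral)
      also have "\<dots> = (LINT y|lborel. ?G y *\<^sub>R f (x + t *\<^sub>R y)) - (LINT y|lborel. ?G y *\<^sub>R (f (t *\<^sub>R y + x) - f x))"
        unfolding scaleR_diff_right add.commute[of _ x] using i1 i2 by simp
      finally have "norm (f x) \<le> norm (LINT y|lborel. ?G y *\<^sub>R f (x + t *\<^sub>R y)) + norm (LINT y|lborel. ?G y *\<^sub>R (f (t *\<^sub>R y + x) - f x))"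
        by (rule ord_eq_le_trans[OF arg_cong[where f = norm] norm_triangle_ineq4])
      moreover have "norm (LINT y|lborel. ?G y *\<^sub>R f (x + t *\<^sub>R y)) \<le> B"
        unfolding B_def by (rule mollification_bound[OF f F t])
      moreover have "norm (LINT y|lborel. ?G y *\<^sub>R (f (t *\<^sub>R y + x) - f x)) \<le> (LINT y|lborel. ?D y x)"
        using integral_norm_bound[of lborel "\<lambda>y. ?G y *\<^sub>R (f (t *\<^sub>R y + x) - f x)"]
        by (simp add: abs_of_nonneg gauss_density_nonneg)
      moreover have "0 \<le> (LINT y|lborel. ?D y x)"
        by (intro integral_nonneg_AE AE_I2 mult_nonneg_nonneg gauss_density_nonneg norm_ge_zero)
      ultimately show ?thesis by linarith
    qed
    then have "(LINT x|lborel. ?e x) \<le> (LINT x|lborel. LINT y|lborel. ?D y x)"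
      using lborel_pair.integrable_snd[OF prodint] by (intro integral_mono ei) auto
    also have "\<dots> = (LINT y|lborel. LINT x|lborel. ?D y x)"
      by (rule lborel_pair.Fubini_integral[OF prodint])
    also have "\<dots> = (LINT y|lborel. ?G y * translation_gap f (t *\<^sub>R y))"
      by (simp add: translation_gap_def)
    finally show ?thesis .
  qed
  have "(LINT x|lborel. ?e x) \<le> 0"
    by (rule LIMSEQ_le_const[OF gaussian_average_translation_gap[OF f]]) (intro exI allI impI step, simp)
  then have "(LINT x|lborel. ?e x) = 0"
    by (intro antisym integral_nonneg_AE) auto
  then have "AE x in lborel. ?e x = 0"
    using integral_nonneg_eq_0_iff_AE[OF ei] by simp
  then show ?thesis unfolding B_def[symmetric]
    by eventually_elim linarith
qed

section \<open>Asymptotics of the symbol\<close>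

definition rate :: "real \<Rightarrow> nat \<Rightarrow> real" where
  "rate \<mu> k = real k * ln (real k) powr \<mu>"

lemma rate_pos: "k \<ge> 2 \<Longrightarrow> rate \<mu> k > 0"
  by (simp add: rate_def)

text \<open>Logarithms are slowly varying. If $a = \ln(1/|\xi|)$, then $a + \ln t$ is the
  logarithm at a point that is \<open>t\<close> times closer to the origin, and the quotient of
  the $\mu$-th powers loses at most a factor of order $t^{\sigma/2}$. Only $\mu > 0$ needs an
  argument, and there $\ln t$ is bounded by a multiple of a small power of
  \<open>t\<close>.\<close>
lemma log_quotient_bound:
  fixes \<sigma> \<mu> a0 :: real
  assumes \<sigma>: "0 < \<sigma>" and a0: "0 < a0"
  shows "\<exists>c>0. \<forall>a\<ge>a0. \<forall>t\<ge>1. c * t powr - (\<sigma> / 2) \<le> (a / (a + ln t)) powr \<mu>"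
proof (cases "\<mu> \<le> 0")
  case True
  have "1 * t powr - (\<sigma> / 2) \<le> (a / (a + ln t)) powr \<mu>" if "a \<ge> a0" "t \<ge> 1" for a t
  proof -
    have pos: "a > 0" "ln t \<ge> 0" using that a0 by auto
    have "t powr - (\<sigma> / 2) \<le> t powr 0"
      using that \<sigma> by (intro powr_mono) auto
    also have "\<dots> = 1" using that by simp
    also have "1 = 1 powr \<mu>" by simp
    also have "\<dots> \<le> (a / (a + ln t)) powr \<mu>"
      using pos True by (intro powr_mono2') auto
    finally show ?thesis by simp
  qed
  then show ?thesis by (intro exI[of _ 1]) auto
next
  case False
  \<comment> \<open>Raising a bound of order $t^e$ to the power $\mu$ should cost exactly $t^{\sigma/2}$.\<close>
  define e where "e = \<sigma> / (2 * \<mu>)"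
  have e: "e > 0" "e * \<mu> = \<sigma> / 2" using False \<sigma> by (auto simp: e_def)
  define M where "M = 1 + 1 / (e * a0)"
  have M: "M > 0" using e a0 by (auto simp: M_def intro: add_pos_pos)
  have "M powr - \<mu> * t powr - (\<sigma> / 2) \<le> (a / (a + ln t)) powr \<mu>" if "a \<ge> a0" "t \<ge> 1" for a t
  proof -
    have pos: "a > 0" "ln t \<ge> 0" using that a0 by auto
    have t1: "1 \<le> t powr e" using that e by (intro ge_one_powr_ge_zero) auto
    have "(a + ln t) / a = 1 + ln t / a" using pos by (simp add: field_simps)
    also have "\<dots> \<le> 1 + ln t / a0" using pos that a0 by (intro add_left_mono divide_left_mono) auto
    also have "\<dots> \<le> t powr e + (t powr e / e) / a0"
      using t1 ln_powr_bound[of t e] that e a0 by (intro add_mono divide_right_mono) auto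
    also have "\<dots> = M * t powr e" by (simp add: M_def algebra_simps)
    finally have "(a + ln t) / a \<le> M * t powr e" .
    then have "1 / (M * t powr e) \<le> a / (a + ln t)"
      using pos M that by (simp add: field_simps add_pos_nonneg)
    then have "(1 / (M * t powr e)) powr \<mu> \<le> (a / (a + ln t)) powr \<mu>"
      using False M by (intro powr_mono2) auto
    also have "(1 / (M * t powr e)) powr \<mu> = M powr - \<mu> * t powr - (\<sigma> / 2)"
      using M by (simp add: powr_divide powr_mult powr_powr e(2) powr_minus divide_simps)
    finally show ?thesis .
  qed
  then show ?thesis using M by (intro exI[of _ "M powr - \<mu>"]) auto
qed

text \<open>Here $s = X_k^{-1/\sigma}$ is the scale at which $k s^\sigma (\ln k)^\mu = 1$, and
  \<open>t\<close> stands for $|\xi| / s$. The quotient of $\ln (1/(st))$ and $\ln k$ is split at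
  $L = \ln (1/s)$: \<open>log_quotient_bound\<close> compares $\ln(1/(st))$ with \<open>L\<close>,
  and $L / \ln k$ tends to $1/\sigma$.\<close>
lemma gauge_scaling:
  fixes \<sigma> \<mu> r :: real
  assumes \<sigma>: "0 < \<sigma>" and r: "0 < r" "r < 1"
  shows "\<exists>c>0. \<forall>\<^sub>F k in sequentially. \<forall>t\<ge>1. rate \<mu> k powr - (1 / \<sigma>) * t \<le> r \<longrightarrow>
     c * t powr (\<sigma> / 2) \<le> real k * ((rate \<mu> k powr - (1 / \<sigma>) * t) powr \<sigma>
       * ln (1 / (rate \<mu> k powr - (1 / \<sigma>) * t)) powr \<mu>)"
proof -
  have "ln (1 / r) > 0" using r by simp
  from log_quotient_bound[OF \<sigma> this, of \<mu>]
  obtain c where c: "c > 0" "\<forall>a\<ge>ln (1 / r). \<forall>t\<ge>1. c * t powr - (\<sigma> / 2) \<le> (a / (a + ln t)) powr \<mu>"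
    by (elim exE conjE)
  have "((\<lambda>k. (ln ((real k * ln (real k) powr \<mu>) powr (1 / \<sigma>)) / ln (real k)) powr \<mu>) \<longlongrightarrow> (1 / \<sigma>) powr \<mu>) sequentially"
    using \<sigma> by real_asymp
  then have lim: "((\<lambda>k. (ln (rate \<mu> k powr (1 / \<sigma>)) / ln (real k)) powr \<mu>) \<longlongrightarrow> (1 / \<sigma>) powr \<mu>) sequentially"
    by (simp add: rate_def)
  define d where "d = (1 / \<sigma>) powr \<mu> / 2"
  have d: "d > 0" "d < (1 / \<sigma>) powr \<mu>" using \<sigma> by (auto simp: d_def)
  have "\<forall>\<^sub>F k in sequentially. d < (ln (rate \<mu> k powr (1 / \<sigma>)) / ln (real k)) powr \<mu>"
    using order_tendstoD(1)[OF lim d(2)] .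
  moreover have "\<forall>\<^sub>F k in sequentially. k \<ge> (2::nat)" by (rule eventually_ge_at_top)
  ultimately have "\<forall>\<^sub>F k in sequentially. \<forall>t\<ge>1. rate \<mu> k powr - (1 / \<sigma>) * t \<le> r \<longrightarrow>
     (c * d) * t powr (\<sigma> / 2) \<le> real k * ((rate \<mu> k powr - (1 / \<sigma>) * t) powr \<sigma>
       * ln (1 / (rate \<mu> k powr - (1 / \<sigma>) * t)) powr \<mu>)"
  proof eventually_elim
    case (elim k)
    show ?case
    proof (intro allI impI)
      fix t :: real assume t: "t \<ge> 1" and tr: "rate \<mu> k powr - (1 / \<sigma>) * t \<le> r"
      define X where "X = rate \<mu> k"
      define s where "s = X powr - (1 / \<sigma>)"
      define L where "L = ln (X powr (1 / \<sigma>))"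
      define a where "a = ln (1 / (s * t))"
      have X: "X > 0" using rate_pos elim by (simp add: X_def)
      have s: "s > 0" using X by (simp add: s_def)
      have lnk: "ln (real k) > 0" using elim by simp
      have "L = - ln s" using X by (simp add: L_def s_def ln_powr)
      then have La: "L = a + ln t" using s t by (simp add: a_def ln_div ln_mult)
      have "1 / r \<le> 1 / (s * t)"
        using tr s t r by (intro divide_left_mono) (auto simp: s_def X_def)
      then have a: "ln (1 / r) \<le> a" using r s t by (simp add: a_def)
      then have apos: "a > 0" using r \<open>ln (1 / r) > 0\<close> by linarith
      then have Lpos: "L > 0" using La t by (simp add: add_pos_nonneg)
      have 1: "c * t powr - (\<sigma> / 2) \<le> (a / L) powr \<mu>"
        unfolding La by (rule c(2)[rule_format, OF a t])
      have 2: "d \<le> (L / ln (real k)) powr \<mu>"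
        using elim by (simp add: L_def X_def)
      have "s powr \<sigma> = X powr (- (1 / \<sigma>) * \<sigma>)" unfolding s_def by (rule powr_powr)
      then have s\<sigma>: "s powr \<sigma> = 1 / X" using X \<sigma> by (simp add: powr_neg_one)
      have kX: "real k / X = 1 / ln (real k) powr \<mu>" using elim lnk by (simp add: X_def rate_def)
      have "(c * d) * t powr (\<sigma> / 2) = t powr \<sigma> * ((c * t powr - (\<sigma> / 2)) * d)"
        using t by (simp add: powr_add[symmetric])
      also have "\<dots> \<le> t powr \<sigma> * ((a / L) powr \<mu> * (L / ln (real k)) powr \<mu>)"
        using c(1) d(1) t by (intro mult_left_mono mult_mono 1 2) auto
      also have "(a / L) powr \<mu> * (L / ln (real k)) powr \<mu> = a powr \<mu> / ln (real k) powr \<mu>"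
        using apos Lpos lnk by (simp add: powr_divide)
      also have "t powr \<sigma> * (a powr \<mu> / ln (real k) powr \<mu>) = (real k / X) * (t powr \<sigma> * a powr \<mu>)"
        unfolding kX by simp
      also have "\<dots> = real k * ((s * t) powr \<sigma> * a powr \<mu>)"
        using s t by (simp add: powr_mult s\<sigma>)
      finally show "(c * d) * t powr (\<sigma> / 2) \<le> real k * ((rate \<mu> k powr - (1 / \<sigma>) * t) powr \<sigma>
       * ln (1 / (rate \<mu> k powr - (1 / \<sigma>) * t)) powr \<mu>)"
        by (simp add: a_def s_def X_def)
    qed
  qed
  then show ?thesis using c(1) d(1) by (intro exI[of _ "c * d"]) auto
qed

lemma exp_le_rate:
  fixes d \<mu> p :: real
  assumes "0 < d" 
  shows "\<forall>\<^sub>F k in sequentially. exp (- d * real k) \<le> rate \<mu> k powr - p"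
proof -
  have "((\<lambda>k. exp (- d * real k) * (real k * ln (real k) powr \<mu>) powr p) \<longlongrightarrow> 0) sequentially"
    using assms by real_asymp
  then have "\<forall>\<^sub>F k in sequentially. exp (- d * real k) * rate \<mu> k powr p < 1"
    unfolding rate_def by (rule order_tendstoD) simp
  moreover have "\<forall>\<^sub>F k in sequentially. k \<ge> (2::nat)" by (rule eventually_ge_at_top)
  ultimately show ?thesis
  proof eventually_elim
    case (elim k)
    have "rate \<mu> k > 0" using elim rate_pos by simp
    then show ?case using elim by (simp add: powr_minus field_simps)
  qed
qed

text \<open>Write \<open>g\<close> for the gauge. It tends to zero at the origin, so $1 - A g$ is
  positive close to it and $|\varphi| \le 1 - A g + \frac A2 g \le e^{-A g / 2}$: half of the
  leading term absorbs the error.\<close>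
lemma symbol_near_0:
  fixes \<phi> :: "real ^ 'n \<Rightarrow> complex"
  assumes \<sigma>: "0 < \<sigma>" and A: "A > 0"
    and exp: "(\<lambda>\<xi>. \<phi> \<xi> - (1 - complex_of_real (A * log_gauge \<sigma> \<mu> \<xi>)))
        \<in> o[at 0](\<lambda>\<xi>. complex_of_real (log_gauge \<sigma> \<mu> \<xi>))"
  shows "\<exists>r>0. r < 1 \<and> (\<forall>\<xi>. \<xi> \<noteq> 0 \<longrightarrow> norm \<xi> < r \<longrightarrow> norm (\<phi> \<xi>) \<le> exp (- (A / 2) * log_gauge \<sigma> \<mu> \<xi>))"
proof -
  have "((\<lambda>t. A * (t powr \<sigma> * ln (1 / t) powr \<mu>)) \<longlongrightarrow> 0) (at_right (0::real))"
    using \<sigma> by real_asymp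
  moreover have "filterlim norm (at_right 0) (at (0 :: real ^ 'n))"
    unfolding filterlim_at by (auto intro!: tendsto_eq_intros simp: eventually_at_filter)
  ultimately have "((\<lambda>\<xi> :: real ^ 'n. A * log_gauge \<sigma> \<mu> \<xi>) \<longlongrightarrow> 0) (at 0)"
    unfolding log_gauge_def by (rule filterlim_compose)
  then have "\<forall>\<^sub>F \<xi> in at (0 :: real ^ 'n). A * log_gauge \<sigma> \<mu> \<xi> < 1"
    by (rule order_tendstoD) simp
  moreover have "\<forall>\<^sub>F \<xi> in at 0. norm (\<phi> \<xi> - (1 - complex_of_real (A * log_gauge \<sigma> \<mu> \<xi>)))
      \<le> (A / 2) * norm (complex_of_real (log_gauge \<sigma> \<mu> \<xi>))"
    using landau_o.smallD[OF exp, of "A / 2"] A by simp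
  ultimately have "\<forall>\<^sub>F \<xi> in at 0. norm (\<phi> \<xi>) \<le> exp (- (A / 2) * log_gauge \<sigma> \<mu> \<xi>)"
  proof eventually_elim
    case (elim \<xi>)
    have g: "log_gauge \<sigma> \<mu> \<xi> \<ge> 0" by (simp add: log_gauge_def)
    have "norm (\<phi> \<xi>) \<le> norm (1 - complex_of_real (A * log_gauge \<sigma> \<mu> \<xi>)) + (A / 2) * log_gauge \<sigma> \<mu> \<xi>"
      using elim(2) g norm_triangle_sub[of "\<phi> \<xi>" "1 - complex_of_real (A * log_gauge \<sigma> \<mu> \<xi>)"] by simp
    also have "1 - complex_of_real (A * log_gauge \<sigma> \<mu> \<xi>) = complex_of_real (1 - A * log_gauge \<sigma> \<mu> \<xi>)"
      by simp
    also have "norm \<dots> = 1 - A * log_gauge \<sigma> \<mu> \<xi>"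
      unfolding norm_of_real using elim(1) by simp
    finally have "norm (\<phi> \<xi>) \<le> 1 + (- (A / 2) * log_gauge \<sigma> \<mu> \<xi>)" by simp
    also have "\<dots> \<le> exp (- (A / 2) * log_gauge \<sigma> \<mu> \<xi>)" by (rule exp_ge_add_one_self)
    finally show ?case .
  qed
  then obtain d where d: "d > 0" "\<And>\<xi>. \<xi> \<noteq> 0 \<Longrightarrow> norm \<xi> < d \<Longrightarrow> norm (\<phi> \<xi>) \<le> exp (- (A / 2) * log_gauge \<sigma> \<mu> \<xi>)"
    unfolding eventually_at by (auto simp: dist_norm)
  show ?thesis
    by (rule exI[of _ "min d (1/2)"]) (use d in auto)
qed

text \<open>The first term on the right covers the vicinity of the origin. Its factor $e^c$ makes
  it at least one where the rescaled variable has norm at most one, and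
  \<open>gauge_scaling\<close> applies beyond. The second term covers the rest, where
  $|\varphi|^k$ decays exponentially in \<open>k\<close>.\<close>
lemma symbol_power_bound:
  fixes \<phi> :: "real ^ 'n \<Rightarrow> complex"
  assumes \<sigma>: "0 < \<sigma>" and A: "A > 0"
    and exp: "(\<lambda>\<xi>. \<phi> \<xi> - (1 - complex_of_real (A * log_gauge \<sigma> \<mu> \<xi>)))
        \<in> o[at 0](\<lambda>\<xi>. complex_of_real (log_gauge \<sigma> \<mu> \<xi>))"
    and le1: "\<And>\<xi>. norm (\<phi> \<xi>) \<le> 1"
    and away: "\<And>r. r > 0 \<Longrightarrow> \<exists>d>0. \<forall>\<xi>. norm \<xi> \<ge> r \<longrightarrow> norm (\<phi> \<xi>) \<le> exp (- d)"
  shows "\<exists>c>0. \<forall>\<^sub>F k in sequentially. \<forall>\<xi>. \<xi> \<noteq> 0 \<longrightarrow>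
     norm (\<phi> \<xi>) ^ k \<le> exp c * exp (- c * norm (rate \<mu> k powr (1 / \<sigma>) *\<^sub>R \<xi>) powr (\<sigma> / 2))
       + rate \<mu> k powr - p"
proof -
  obtain r where r: "r > 0" "r < 1" 
    "\<And>\<xi>. \<xi> \<noteq> 0 \<Longrightarrow> norm \<xi> < r \<Longrightarrow> norm (\<phi> \<xi>) \<le> exp (- (A / 2) * log_gauge \<sigma> \<mu> \<xi>)"
    using symbol_near_0[OF \<sigma> A exp] by blast
  obtain d where d: "d > 0" "\<And>\<xi>. norm \<xi> \<ge> r \<Longrightarrow> norm (\<phi> \<xi>) \<le> exp (- d)"
    using away[OF r(1)] by blast
  obtain c0 where c0: "c0 > 0" and ev: "\<forall>\<^sub>F k in sequentially. \<forall>t\<ge>1. rate \<mu> k powr - (1 / \<sigma>) * t \<le> r \<longrightarrow>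
     c0 * t powr (\<sigma> / 2) \<le> real k * ((rate \<mu> k powr - (1 / \<sigma>) * t) powr \<sigma>
       * ln (1 / (rate \<mu> k powr - (1 / \<sigma>) * t)) powr \<mu>)"
    using gauge_scaling[OF \<sigma> r(1,2)] by blast
  define c where "c = A / 2 * c0"
  have c: "c > 0" using A c0 by (simp add: c_def)
  have "\<forall>\<^sub>F k in sequentially. k \<ge> (2::nat)" by (rule eventually_ge_at_top)
  with ev exp_le_rate[OF d(1), of \<mu> p]
  have "\<forall>\<^sub>F k in sequentially. \<forall>\<xi>. \<xi> \<noteq> 0 \<longrightarrow>
     norm (\<phi> \<xi>) ^ k \<le> exp c * exp (- c * norm (rate \<mu> k powr (1 / \<sigma>) *\<^sub>R \<xi>) powr (\<sigma> / 2))
       + rate \<mu> k powr - p"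
  proof eventually_elim
    case (elim k)
    show ?case
    proof (intro allI impI)
      fix \<xi> :: "real ^ 'n" assume \<xi>: "\<xi> \<noteq> 0"
      have X: "rate \<mu> k > 0" using rate_pos elim by simp
      define t where "t = norm (rate \<mu> k powr (1 / \<sigma>) *\<^sub>R \<xi>)"
      have st: "rate \<mu> k powr - (1 / \<sigma>) * t = norm \<xi>"
        using X by (simp add: t_def powr_minus)
      have t0: "t \<ge> 0" by (simp add: t_def)
      show "norm (\<phi> \<xi>) ^ k \<le> exp c * exp (- c * norm (rate \<mu> k powr (1 / \<sigma>) *\<^sub>R \<xi>) powr (\<sigma> / 2))
       + rate \<mu> k powr - p"
      proof (cases "norm \<xi> < r")
        case False
        have "norm (\<phi> \<xi>) ^ k \<le> exp (- d) ^ k"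
          using d(2) False by (intro power_mono) auto
        also have "\<dots> = exp (- d * real k)" by (simp add: exp_of_nat_mult[symmetric] mult.commute)
        also have "\<dots> \<le> rate \<mu> k powr - p" by (rule elim)
        finally show ?thesis by (rule add_increasing[rotated]) simp
      next
        case small: True
        have "norm (\<phi> \<xi>) ^ k \<le> exp c * exp (- c * t powr (\<sigma> / 2))"
        proof (cases "t \<ge> 1")
          case True
          have "c0 * t powr (\<sigma> / 2) \<le> real k * log_gauge \<sigma> \<mu> \<xi>"
            using elim(1)[rule_format, OF True] small unfolding st log_gauge_def by simp
          then have "(A / 2) * (c0 * t powr (\<sigma> / 2)) \<le> (A / 2) * (real k * log_gauge \<sigma> \<mu> \<xi>)"
            using A by (intro mult_left_mono) auto
          then have *: "real k * (- (A / 2) * log_gauge \<sigma> \<mu> \<xi>) \<le> - c * t powr (\<sigma> / 2)"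
            by (simp add: c_def mult_ac)
          have "norm (\<phi> \<xi>) ^ k \<le> exp (- (A / 2) * log_gauge \<sigma> \<mu> \<xi>) ^ k"
            using r(3)[OF \<xi> small] by (intro power_mono) auto
          also have "\<dots> = exp (real k * (- (A / 2) * log_gauge \<sigma> \<mu> \<xi>))"
            by (rule exp_of_nat_mult[symmetric])
          also have "\<dots> \<le> 1 * exp (- c * t powr (\<sigma> / 2))" using * by simp
          also have "\<dots> \<le> exp c * exp (- c * t powr (\<sigma> / 2))" using c by (intro mult_right_mono) auto
          finally show ?thesis .
        next
          case False
          then have "t powr (\<sigma> / 2) \<le> 1" using t0 \<sigma> by (intro powr_le1) auto
          then have "c * t powr (\<sigma> / 2) \<le> c" using c mult_left_mono[of _ 1 c] by simp
          then have "1 \<le> exp (c + - c * t powr (\<sigma> / 2))" by simp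
          moreover have "norm (\<phi> \<xi>) ^ k \<le> 1" by (intro power_le_one le1) simp
          ultimately show ?thesis by (simp only: exp_add)
        qed
        also have "\<dots> \<le> exp c * exp (- c * t powr (\<sigma> / 2)) + rate \<mu> k powr - p" by simp
        finally show ?thesis by (simp add: t_def)
      qed
    qed
  qed
  with c show ?thesis by blast
qed

section \<open>Convolution on Lebesgue integrable functions\<close>

lemma borel_representative:
  fixes u :: "'a::euclidean_space \<Rightarrow> complex"
  assumes u: "integrable lebesgue u"
  shows "\<exists>v. integrable lborel v \<and> (AE x in lborel. u x = v x)"
proof -
  have um: "u \<in> borel_measurable lebesgue" using u by (rule borel_measurable_integrable)
  then have "(\<lambda>x. Re (u x)) \<in> borel_measurable lebesgue" "(\<lambda>x. Im (u x)) \<in> borel_measurable lebesgue"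
    by measurable
  then obtain a b where ab: "a \<in> borel_measurable lborel" "AE x in lborel. Re (u x) = a x"
      "b \<in> borel_measurable lborel" "AE x in lborel. Im (u x) = b x"
    using completion_ex_borel_measurable_real by blast
  define v where "v = (\<lambda>x. Complex (a x) (b x))"
  have v: "v \<in> borel_measurable lborel"
    using ab(1,3) unfolding v_def Complex_eq by measurable
  have ae: "AE x in lborel. u x = v x"
    using ab(2,4) by eventually_elim (simp add: v_def complex_eq_iff)
  have "integrable lebesgue v"
    using u integrable_cong_AE[OF um measurable_completion[OF v] AE_completion[OF ae]] by simp
  then have "integrable lborel v" using integrable_completion[OF v] by simp
  with ae show ?thesis by blast
qed

text \<open>Taking the positive part keeps the representative nonnegative everywhere.\<close>
lemma borel_representative_real:
  fixes J :: "'a::euclidean_space \<Rightarrow> real"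
  assumes J: "integrable lebesgue J" and nn: "\<And>x. 0 \<le> J x"
  shows "\<exists>K. integrable lborel K \<and> (\<forall>x. 0 \<le> K x) \<and> (AE x in lborel. J x = K x)"
proof -
  obtain a where a: "a \<in> borel_measurable lborel" "AE x in lborel. J x = a x"
    using completion_ex_borel_measurable_real[OF borel_measurable_integrable[OF J]] by blast
  define K where "K = (\<lambda>x. max 0 (a x))"
  have K: "K \<in> borel_measurable lborel" using a(1) by (simp add: K_def)
  have ae: "AE x in lborel. J x = K x" using a(2)
  proof eventually_elim
    case (elim x)
    then show ?case using nn[of x] by (simp add: K_def)
  qed
  have "integrable lebesgue K"
    using J integrable_cong_AE[OF borel_measurable_integrable[OF J] measurable_completion[OF K] AE_completion[OF ae]] by simp
  then have "integrable lborel K" using integrable_completion[OF K] by simp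
  with ae show ?thesis by (auto simp: K_def)
qed

lemma integral_lebesgue_AE_eq:
  fixes f g :: "'a::euclidean_space \<Rightarrow> 'b::euclidean_space"
  assumes g: "g \<in> borel_measurable borel" and ae: "AE x in lborel. f x = g x"
  shows "(LINT x|lebesgue. f x) = (LINT x|lborel. g x)"
proof -
  have gm: "g \<in> borel_measurable lebesgue" using g by (simp add: measurable_completion)
  have "f \<in> borel_measurable lebesgue"
    by (rule borel_measurable_AE[OF gm]) (use ae in \<open>auto simp: AE_completion_iff eq_commute\<close>)
  then have "(LINT x|lebesgue. f x) = (LINT x|lebesgue. g x)"
    by (intro integral_cong_AE gm) (use ae in \<open>simp_all add: AE_completion_iff\<close>)
  also have "\<dots> = (LINT x|lborel. g x)"
    by (rule integral_completion) (use g in simp)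
  finally show ?thesis .
qed

lemma fourier_cong_AE:
  fixes f g :: "real ^ 'n \<Rightarrow> complex"
  assumes g: "g \<in> borel_measurable borel" and ae: "AE x in lborel. f x = g x"
  shows "fourier f = fourier g"
proof
  fix \<xi> :: "real ^ 'n"
  show "fourier f \<xi> = fourier g \<xi>"
    unfolding fourier_lborel[OF g] unfolding fourier_def
    by (rule integral_lebesgue_AE_eq) (use g ae in auto)
qed

lemma AE_lborel_reflect:
  fixes x :: "'a::euclidean_space"
  assumes "AE y in lborel. P y"
  shows "AE y in lborel. P (x - y)"
proof -
  from assms obtain N where N: "{y. \<not> P y} \<subseteq> N" "emeasure lborel N = 0" "N \<in> sets borel"
    by (auto elim: AE_E)
  have "lborel = distr lborel borel (\<lambda>y. x - y)"
    using lborel_affine[of "-1" x] by (simp add: density_1)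
  with N(2) have "emeasure (distr lborel borel (\<lambda>y. x - y)) N = 0" by simp
  then have "emeasure lborel ((\<lambda>y. x - y) -` N) = 0"
    using N(3) by (simp add: emeasure_distr)
  moreover have "(\<lambda>y. x - y) -` N \<in> sets borel"
    using measurable_sets_borel[OF _ N(3), of "\<lambda>y. x - y"] by simp
  ultimately show ?thesis
    by (intro AE_I[where N="(\<lambda>y. x - y) -` N"]) (use N(1) in auto)
qed

text \<open>The two convolutions agree at every point, since each value is an integral, which does
  not see null sets. Hence Borel representatives compute the convolution of Lebesgue measurable
  functions exactly.\<close>
lemma conv_op_cong_AE:
  fixes J K :: "real ^ 'n \<Rightarrow> real" and u v :: "real ^ 'n \<Rightarrow> complex"
  assumes [measurable]: "K \<in> borel_measurable borel" "v \<in> borel_measurable borel"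
    and J: "AE x in lborel. J x = K x" and u: "AE x in lborel. u x = v x"
  shows "conv_op J u x = (LINT y|lborel. K (x - y) *\<^sub>R v y)"
  unfolding conv_op_def
proof (rule integral_lebesgue_AE_eq)
  show "AE y in lborel. J (x - y) *\<^sub>R u y = K (x - y) *\<^sub>R v y"
    using AE_lborel_reflect[OF J, of x] u by eventually_elim simp
qed measurable

lemma convolution_integrable_product:
  fixes K :: "real ^ 'n \<Rightarrow> real" and v :: "real ^ 'n \<Rightarrow> complex"
  assumes K: "integrable lborel K" and v: "integrable lborel v"
  shows "integrable (lborel \<Otimes>\<^sub>M lborel) (\<lambda>(y, x). K (x - y) *\<^sub>R v y)"
proof (rule lborel_pair.Fubini_integrable)
  have [measurable]: "K \<in> borel_measurable borel" "v \<in> borel_measurable borel"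
    using K[THEN borel_measurable_integrable] v[THEN borel_measurable_integrable] by simp_all
  show "(\<lambda>(y, x). K (x - y) *\<^sub>R v y) \<in> borel_measurable (lborel \<Otimes>\<^sub>M lborel)"
    by measurable
  have Ks: "integrable lborel (\<lambda>x. K (x - y))" for y
    using integrable_translation[OF K, of "- y"] by simp
  then show "AE y in lborel. integrable lborel (\<lambda>x. case (y, x) of (y, x) \<Rightarrow> K (x - y) *\<^sub>R v y)"
    by simp
  have "(LINT x|lborel. \<bar>K (x - y)\<bar>) = (LINT x|lborel. \<bar>K x\<bar>)" for y
    using integral_translation[of "\<lambda>x. \<bar>K x\<bar>" "- y"] by simp
  then show "integrable lborel (\<lambda>y. LINT x|lborel. norm (case (y, x) of (y, x) \<Rightarrow> K (x - y) *\<^sub>R v y))"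
    using v by simp
qed

text \<open>All three claims are Fubini's theorem for Borel representatives.\<close>
lemma conv_op_L1:
  fixes J :: "real ^ 'n \<Rightarrow> real" and u :: "real ^ 'n \<Rightarrow> complex"
  assumes J: "integrable lebesgue J" "\<And>x. 0 \<le> J x" and u: "integrable lebesgue u"
  shows conv_op_integrable: "integrable lebesgue (conv_op J u)"
    and conv_op_norm_le: "(LINT x|lebesgue. norm (conv_op J u x)) \<le> (LINT x|lebesgue. J x) * (LINT x|lebesgue. norm (u x))"
    and fourier_conv_op: "fourier (conv_op J u) \<xi> = fourier (\<lambda>x. complex_of_real (J x)) \<xi> * fourier u \<xi>"
proof -
  obtain K where K: "integrable lborel K" "\<And>x. 0 \<le> K x" "AE x in lborel. J x = K x"
    using borel_representative_real[OF J] by blast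
  obtain v where v: "integrable lborel v" "AE x in lborel. u x = v x"
    using borel_representative[OF u] by blast
  have [measurable]: "K \<in> borel_measurable borel" "v \<in> borel_measurable borel"
    using K(1)[THEN borel_measurable_integrable] v(1)[THEN borel_measurable_integrable] by simp_all
  have cK: "(\<lambda>x. complex_of_real (K x)) \<in> borel_measurable borel" by measurable
  have conv: "conv_op J u = (\<lambda>x. LINT y|lborel. K (x - y) *\<^sub>R v y)"
    by (intro ext conv_op_cong_AE K(3) v(2)) measurable
  note P = convolution_integrable_product[OF K(1) v(1)]
  have Pn: "integrable (lborel \<Otimes>\<^sub>M lborel) (\<lambda>(y, x). norm (K (x - y) *\<^sub>R v y))"
    using integrable_norm[OF P] by (simp add: split_beta')
  have ci: "integrable lborel (conv_op J u)"
    unfolding conv by (rule lborel_pair.integrable_snd[OF P])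
  then have cm [measurable]: "conv_op J u \<in> borel_measurable borel"
    using borel_measurable_integrable by force
  show "integrable lebesgue (conv_op J u)"
    using ci by (simp add: integrable_completion)
  have Kt: "(LINT x|lborel. K (x - y)) = (LINT x|lborel. K x)" for y
    using integral_translation[of K "- y"] by simp
  have "(LINT x|lebesgue. norm (conv_op J u x)) = (LINT x|lborel. norm (conv_op J u x))"
    by (rule integral_completion) simp
  also have "\<dots> \<le> (LINT x|lborel. LINT y|lborel. norm (K (x - y) *\<^sub>R v y))"
  proof (rule integral_mono)
    show "integrable lborel (\<lambda>x. LINT y|lborel. norm (K (x - y) *\<^sub>R v y))"
      by (rule lborel_pair.integrable_snd[OF Pn])
    show "norm (conv_op J u x) \<le> (LINT y|lborel. norm (K (x - y) *\<^sub>R v y))" for x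
      unfolding conv by (rule integral_norm_bound)
  qed (use ci in simp)
  also have "\<dots> = (LINT y|lborel. LINT x|lborel. norm (K (x - y) *\<^sub>R v y))"
    by (rule lborel_pair.Fubini_integral[OF Pn])
  also have "\<dots> = (LINT x|lborel. K x) * (LINT y|lborel. norm (v y))"
    by (simp add: Kt abs_of_nonneg K(2))
  also have "(LINT x|lborel. K x) = (LINT x|lebesgue. J x)"
    by (rule integral_lebesgue_AE_eq[symmetric]) (use K(3) in auto)
  also have "(LINT y|lborel. norm (v y)) = (LINT x|lebesgue. norm (u x))"
    by (rule integral_lebesgue_AE_eq[symmetric]) (use v(2) in auto)
  finally show "(LINT x|lebesgue. norm (conv_op J u x)) \<le> (LINT x|lebesgue. J x) * (LINT x|lebesgue. norm (u x))" .
  have ph: "(\<lambda>z::(real^'n) \<times> (real^'n). phase (snd z \<bullet> \<xi>)) \<in> borel_measurable (lborel \<Otimes>\<^sub>M lborel)"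
  proof -
    have "(\<lambda>z::(real^'n) \<times> (real^'n). phase (snd z \<bullet> \<xi>)) \<in> borel_measurable borel"
      by (intro borel_measurable_continuous_onI continuous_intros)
    then show ?thesis by (simp add: borel_prod[symmetric])
  qed
  have Pp: "integrable (lborel \<Otimes>\<^sub>M lborel) (\<lambda>(y, x). (K (x - y) *\<^sub>R v y) * phase (x \<bullet> \<xi>))"
    by (rule Bochner_Integration.integrable_bound[OF P])
      (use P[THEN borel_measurable_integrable] ph in \<open>auto simp: split_beta' norm_mult\<close>)
  have "fourier (conv_op J u) \<xi> = (LINT x|lborel. conv_op J u x * phase (x \<bullet> \<xi>))"
    by (rule fourier_lborel[OF cm])
  also have "\<dots> = (LINT x|lborel. LINT y|lborel. (K (x - y) *\<^sub>R v y) * phase (x \<bullet> \<xi>))"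
    unfolding conv by (simp only: integral_mult_left_zero)
  also have "\<dots> = (LINT y|lborel. LINT x|lborel. (K (x - y) *\<^sub>R v y) * phase (x \<bullet> \<xi>))"
    by (rule lborel_pair.Fubini_integral[OF Pp])
  also have "\<dots> = (LINT y|lborel. fourier (\<lambda>x. complex_of_real (K x)) \<xi> * (v y * phase (y \<bullet> \<xi>)))"
  proof (intro Bochner_Integration.integral_cong refl)
    fix y
    have "(LINT x|lborel. (K (x - y) *\<^sub>R v y) * phase (x \<bullet> \<xi>))
      = (LINT x|lborel. (\<lambda>x. (complex_of_real (K x) * phase (x \<bullet> \<xi>)) * (v y * phase (y \<bullet> \<xi>))) (- y + x))"
    proof (intro Bochner_Integration.integral_cong refl)
      fix x
      have "phase (x \<bullet> \<xi>) = phase ((- y + x) \<bullet> \<xi>) * phase (y \<bullet> \<xi>)"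
        unfolding phase_add[symmetric] by (simp add: inner_add_left inner_diff_left)
      then show "(K (x - y) *\<^sub>R v y) * phase (x \<bullet> \<xi>)
        = (\<lambda>x. (complex_of_real (K x) * phase (x \<bullet> \<xi>)) * (v y * phase (y \<bullet> \<xi>))) (- y + x)"
        by (simp only: scaleR_conv_of_real mult_ac) simp
    qed
    also have "\<dots> = (LINT x|lborel. (complex_of_real (K x) * phase (x \<bullet> \<xi>)) * (v y * phase (y \<bullet> \<xi>)))"
      by (rule integral_translation) measurable
    also have "\<dots> = fourier (\<lambda>x. complex_of_real (K x)) \<xi> * (v y * phase (y \<bullet> \<xi>))"
      unfolding fourier_lborel[OF cK] by (rule integral_mult_left_zero)
    finally show "(LINT x|lborel. (K (x - y) *\<^sub>R v y) * phase (x \<bullet> \<xi>))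
      = fourier (\<lambda>x. complex_of_real (K x)) \<xi> * (v y * phase (y \<bullet> \<xi>))" .
  qed
  also have "\<dots> = fourier (\<lambda>x. complex_of_real (K x)) \<xi> * fourier v \<xi>"
    unfolding integral_mult_right_zero by (simp only: fourier_lborel[OF \<open>v \<in> borel_measurable borel\<close>])
  also have "fourier (\<lambda>x. complex_of_real (K x)) = fourier (\<lambda>x. complex_of_real (J x))"
    by (rule fourier_cong_AE[symmetric, OF cK]) (use K(3) in simp)
  also have "fourier v = fourier u"
    by (rule fourier_cong_AE[symmetric]) (use v(2) in simp_all)
  finally show "fourier (conv_op J u) \<xi> = fourier (\<lambda>x. complex_of_real (J x)) \<xi> * fourier u \<xi>" .
qed

section \<open>Rescaling the symbol\<close>

text \<open>The stretched exponential decays faster than $(1 + |x|^2)^{-n}$, which is at most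
  $\prod_b (1 + x_b^2)^{-1}$, a product of integrable functions of one variable.\<close>
lemma stretched_exponential_integrable:
  fixes c \<alpha> :: real
  assumes c: "c > 0" and \<alpha>: "\<alpha> > 0"
  shows "integrable lborel (\<lambda>x::'a::euclidean_space. exp (- c * norm x powr \<alpha>))"
proof -
  define n where "n = DIM('a)"
  have "((\<lambda>t::real. exp (- c * t powr \<alpha>) * (1 + t powr 2) powr real n) \<longlongrightarrow> 0) at_top"
    using c \<alpha> by real_asymp
  then have "\<forall>\<^sub>F t::real in at_top. exp (- c * t powr \<alpha>) * (1 + t powr 2) powr real n < 1"
    by (rule order_tendstoD) simp
  then obtain T where T: "\<And>t. t \<ge> T \<Longrightarrow> exp (- c * t powr \<alpha>) * (1 + t powr 2) powr real n < 1"
    by (auto simp: eventually_at_top_linorder)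
  define M where "M = max 1 ((1 + T\<^sup>2) ^ n)"
  have bd: "exp (- c * t powr \<alpha>) * (1 + t\<^sup>2) ^ n \<le> M" if "t \<ge> 0" for t
  proof (cases "t \<ge> T")
    case True
    have "1 + t\<^sup>2 > 0" by (simp add: add_pos_nonneg)
    then have "(1 + t\<^sup>2) ^ n = (1 + t powr 2) powr real n"
      using that by (simp add: powr_realpow)
    with T[OF True] have "exp (- c * t powr \<alpha>) * (1 + t\<^sup>2) ^ n \<le> 1" by simp
    then show ?thesis unfolding M_def by (rule max.coboundedI1)
  next
    case False
    have "exp (- c * t powr \<alpha>) * (1 + t\<^sup>2) ^ n \<le> 1 * (1 + T\<^sup>2) ^ n"
      using False that c by (intro mult_mono power_mono add_left_mono) auto
    then show ?thesis by (simp add: M_def)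
  qed
  have i1: "integrable lborel (\<lambda>t::real. inverse (1 + t\<^sup>2))"
    using integrable_inverse_1_plus_square by (simp add: set_integrable_def)
  have i2: "integrable lborel (\<lambda>x::'a. M * (\<Prod>b\<in>Basis. inverse (1 + (x \<bullet> b)\<^sup>2)))"
    by (intro integrable_mult_right lborel_prod_integrable i1)
  show ?thesis
  proof (rule Bochner_Integration.integrable_bound[OF i2])
    show "AE x in lborel. norm (exp (- c * norm x powr \<alpha>)) \<le> norm (M * (\<Prod>b\<in>(Basis :: 'a set). inverse (1 + (x \<bullet> b)\<^sup>2)))"
    proof (intro AE_I2)
      fix x :: 'a
      have pos: "0 < (\<Prod>b\<in>(Basis :: 'a set). 1 + (x \<bullet> b)\<^sup>2)"
        by (intro prod_pos) (simp add: add_pos_nonneg)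
      have "(\<Prod>b\<in>(Basis :: 'a set). 1 + (x \<bullet> b)\<^sup>2) \<le> (\<Prod>b\<in>(Basis :: 'a set). 1 + (norm x)\<^sup>2)"
        by (intro prod_mono) (auto simp: abs_le_square_iff[symmetric] Basis_le_norm)
      also have "\<dots> = (1 + (norm x)\<^sup>2) ^ n" by (simp add: n_def)
      finally have "exp (- c * norm x powr \<alpha>) * (\<Prod>b\<in>(Basis :: 'a set). 1 + (x \<bullet> b)\<^sup>2)
          \<le> exp (- c * norm x powr \<alpha>) * (1 + (norm x)\<^sup>2) ^ n"
        by (intro mult_left_mono) auto
      also have "\<dots> \<le> M" by (rule bd) simp
      finally have "exp (- c * norm x powr \<alpha>) \<le> M / (\<Prod>b\<in>(Basis :: 'a set). 1 + (x \<bullet> b)\<^sup>2)"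
        using pos by (simp add: pos_le_divide_eq)
      also have "\<dots> = M * (\<Prod>b\<in>(Basis :: 'a set). inverse (1 + (x \<bullet> b)\<^sup>2))"
        unfolding divide_inverse prod_inversef[symmetric] by (simp add: o_def)
      finally show "norm (exp (- c * norm x powr \<alpha>)) \<le> norm (M * (\<Prod>b\<in>(Basis :: 'a set). inverse (1 + (x \<bullet> b)\<^sup>2)))"
        by simp
    qed
  qed measurable
qed

text \<open>The term $X^{-n/\sigma}$ of the pointwise bound is integrated against $|F|$, and the
  other one against the bound \<open>M\<close> of $|F|$, where the substitution $\eta =
  X^{1/\sigma} \xi$ produces the same power of \<open>X\<close> as its Jacobian.\<close>
lemma integral_symbol_power_bound:
  fixes \<phi> F :: "real ^ 'n \<Rightarrow> complex"
  assumes c: "c > 0" and \<sigma>: "\<sigma> > 0" and X: "X > 0"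
    and pw: "\<And>\<xi>. \<xi> \<noteq> 0 \<Longrightarrow> norm (\<phi> \<xi>) ^ k \<le> exp c * exp (- c * norm (X powr (1 / \<sigma>) *\<^sub>R \<xi>) powr (\<sigma> / 2)) + X powr - (real CARD('n) / \<sigma>)"
    and F: "integrable lborel F" "\<And>\<xi>. norm (F \<xi>) \<le> M"
    and \<phi>F: "integrable lborel (\<lambda>\<xi>. \<phi> \<xi> ^ k * F \<xi>)"
  shows "(LINT \<xi>|lborel. norm (\<phi> \<xi> ^ k * F \<xi>)) \<le>
    (exp c * (LINT \<eta>|lborel. exp (- c * norm (\<eta> :: real ^ 'n) powr (\<sigma> / 2))) * M + (LINT \<xi>|lborel. norm (F \<xi>)))
      * X powr - (real CARD('n) / \<sigma>)"
proof -
  \<comment> \<open>$s^n$ is the Jacobian of $\xi \mapsto s \xi$, hence $Y s^n = 1$.\<close>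
  define s where "s = X powr (1 / \<sigma>)"
  have s: "s > 0" using X by (simp add: s_def)
  define Y where "Y = X powr - (real CARD('n) / \<sigma>)"
  have "s ^ CARD('n) = s powr real CARD('n)" using s by (simp add: powr_realpow)
  also have "\<dots> = X powr (real CARD('n) / \<sigma>)" by (simp add: s_def powr_powr)
  finally have Y: "Y * s ^ CARD('n) = 1" using X by (simp add: Y_def powr_minus)
  let ?h = "\<lambda>\<eta> :: real ^ 'n. exp (- c * norm \<eta> powr (\<sigma> / 2))"
  have h: "integrable lborel ?h"
    by (rule stretched_exponential_integrable) (use c \<sigma> in auto)
  have hs: "integrable lborel (\<lambda>\<xi>. ?h (s *\<^sub>R \<xi>))"
    using lborel_affine_integrable_iff[of ?h s 0] h s by simp
  have "(LINT \<eta>|lborel. ?h \<eta>) = s ^ CARD('n) * (LINT \<xi>|lborel. ?h (s *\<^sub>R \<xi>))"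
    using lborel_affine_integral_eq[of ?h s 0] s by simp
  then have hY: "(LINT \<xi>|lborel. ?h (s *\<^sub>R \<xi>)) = (LINT \<eta>|lborel. ?h \<eta>) * Y"
    using Y by (simp add: mult.assoc mult.left_commute[of _ Y] mult.commute[of _ Y])
  have M: "0 \<le> M" using F(2)[of 0] norm_ge_zero[of "F 0"] by linarith
  have "AE \<xi> in lborel. \<xi> \<noteq> (0 :: real ^ 'n)"
    using AE_lborel_singleton[of "0 :: real ^ 'n"] by simp
  then have "(LINT \<xi>|lborel. norm (\<phi> \<xi> ^ k * F \<xi>)) \<le> (LINT \<xi>|lborel. (exp c * ?h (s *\<^sub>R \<xi>)) * M + Y * norm (F \<xi>))"
  proof (intro integral_mono_AE)
    show "integrable lborel (\<lambda>\<xi>. (exp c * ?h (s *\<^sub>R \<xi>)) * M + Y * norm (F \<xi>))"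
      by (intro Bochner_Integration.integrable_add integrable_mult_left integrable_mult_right integrable_norm hs F(1))
    assume "AE \<xi> in lborel. \<xi> \<noteq> (0 :: real ^ 'n)"
    then show "AE \<xi> in lborel. norm (\<phi> \<xi> ^ k * F \<xi>) \<le> (exp c * ?h (s *\<^sub>R \<xi>)) * M + Y * norm (F \<xi>)"
    proof eventually_elim
      case (elim \<xi>)
      have "norm (\<phi> \<xi> ^ k * F \<xi>) = norm (\<phi> \<xi>) ^ k * norm (F \<xi>)"
        by (simp add: norm_mult norm_power)
      also have "\<dots> \<le> (exp c * ?h (s *\<^sub>R \<xi>) + Y) * norm (F \<xi>)"
        using pw[OF elim] by (intro mult_right_mono) (auto simp: s_def Y_def)
      also have "\<dots> = (exp c * ?h (s *\<^sub>R \<xi>)) * norm (F \<xi>) + Y * norm (F \<xi>)"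
        by (simp add: ring_distribs)
      also have "\<dots> \<le> (exp c * ?h (s *\<^sub>R \<xi>)) * M + Y * norm (F \<xi>)"
        by (intro add_right_mono mult_left_mono F(2)) simp
      finally show ?case .
    qed
  qed (use \<phi>F in simp)
  also have "\<dots> = exp c * ((LINT \<eta>|lborel. ?h \<eta>) * Y) * M + Y * (LINT \<xi>|lborel. norm (F \<xi>))"
    unfolding hY[symmetric] using hs F(1) by simp
  also have "\<dots> = (exp c * (LINT \<eta>|lborel. ?h \<eta>) * M + (LINT \<xi>|lborel. norm (F \<xi>))) * Y"
    by (simp add: algebra_simps)
  finally show ?thesis by (simp add: Y_def)
qed

section \<open>Interpolation and the decay estimate\<close>

lemma ereal_one_minus_inverse:
  assumes "1 \<le> r"
  shows "real_of_ereal (1 - 1 / ereal r) = 1 - 1 / r"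
proof -
  have "1 - 1 / ereal r = ereal (1 - 1 / r)" using assms by (simp add: one_ereal_def)
  then show ?thesis by simp
qed

lemma bounded_L1_in_Lp:
  fixes f :: "real ^ 'n \<Rightarrow> complex"
  assumes f: "integrable lebesgue f" and B: "AE x in lebesgue. norm (f x) \<le> B" and p: "1 \<le> p"
  shows "f \<in> Lp_space p"
proof (cases p)
  case (real r)
  then have r: "1 \<le> r" using p by simp
  have fm [measurable]: "f \<in> borel_measurable lebesgue" using f by (rule borel_measurable_integrable)
  have "integrable lebesgue (\<lambda>x. norm (f x) powr r)"
  proof (rule Bochner_Integration.integrable_bound)
    show "integrable lebesgue (\<lambda>x. \<bar>B\<bar> powr (r - 1) * norm (f x))"
      using f by (intro integrable_mult_right integrable_norm)
    show "AE x in lebesgue. norm (norm (f x) powr r) \<le> norm (\<bar>B\<bar> powr (r - 1) * norm (f x))"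
      using B
    proof eventually_elim
      case (elim x)
      have "norm (f x) powr r = norm (f x) powr (r - 1) * norm (f x)"
        by (cases "f x = 0") (simp_all add: powr_diff)
      also have "\<dots> \<le> \<bar>B\<bar> powr (r - 1) * norm (f x)"
        using elim r by (intro mult_right_mono powr_mono2) auto
      finally show ?case by (simp add: abs_mult)
    qed
  qed measurable
  then show ?thesis using fm real by (simp add: Lp_space_def)
next
  case PInf
  have fm [measurable]: "f \<in> borel_measurable lebesgue" using f by (rule borel_measurable_integrable)
  have "esssup lebesgue (\<lambda>x. ereal (norm (f x))) \<le> ereal B"
    by (rule esssup_I) (use B in auto)
  then show ?thesis using fm PInf by (auto simp: Lp_space_def intro: le_less_trans)
qed (use p in auto)

text \<open>Integrate $|f|^r \le B^{r-1} |f|$ with $B = C T Y$. The factor \<open>T\<close>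
  appears with total exponent $(1 - 1/r) + 1/r = 1$, and $C^{1 - 1/r} \le C$ as $C \ge 1$. This
  frees the constant from the exponent.\<close>
lemma Lp_norm_interpolation:
  fixes f :: "real ^ 'n \<Rightarrow> complex"
  assumes f: "integrable lebesgue f" and T: "(LINT x|lebesgue. norm (f x)) \<le> T"
    and B: "AE x in lebesgue. norm (f x) \<le> C * T * Y" and C: "1 \<le> C" and Y: "0 < Y" and p: "1 \<le> p"
  shows "Lp_norm p f \<le> C * T * Y powr real_of_ereal (1 - 1 / p)"
proof -
  have fm [measurable]: "f \<in> borel_measurable lebesgue" using f by (rule borel_measurable_integrable)
  have T0: "0 \<le> T" using T by (rule order_trans[rotated]) simp
  show ?thesis
  proof (cases p)
    case (real r)
    then have r: "1 \<le> r" using p by simp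
    define B' where "B' = C * T * Y"
    have B'0: "0 \<le> B'" using C T0 Y by (simp add: B'_def)
    have q: "0 \<le> 1 - 1 / r" "1 - 1 / r \<le> 1" using r by auto
    have "(LINT x|lebesgue. norm (f x) powr r) \<le> (LINT x|lebesgue. B' powr (r - 1) * norm (f x))"
    proof (rule integral_mono_AE)
      show "integrable lebesgue (\<lambda>x. norm (f x) powr r)"
        using bounded_L1_in_Lp[OF f B p] real by (simp add: Lp_space_def)
      show "integrable lebesgue (\<lambda>x. B' powr (r - 1) * norm (f x))"
        using f by (intro integrable_mult_right integrable_norm)
      show "AE x in lebesgue. norm (f x) powr r \<le> B' powr (r - 1) * norm (f x)"
        using B
      proof eventually_elim
        case (elim x)
        have "norm (f x) powr r = norm (f x) powr (r - 1) * norm (f x)"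
          by (cases "f x = 0") (simp_all add: powr_diff)
        also have "\<dots> \<le> B' powr (r - 1) * norm (f x)"
          using elim r by (intro mult_right_mono powr_mono2) (auto simp: B'_def)
        finally show ?case .
      qed
    qed
    also have "\<dots> = B' powr (r - 1) * (LINT x|lebesgue. norm (f x))" by simp
    also have "\<dots> \<le> B' powr (r - 1) * T" using T by (intro mult_left_mono) auto
    finally have "(LINT x|lebesgue. norm (f x) powr r) powr (1 / r) \<le> (B' powr (r - 1) * T) powr (1 / r)"
      using r by (intro powr_mono2) (auto intro!: integral_nonneg_AE)
    also have "\<dots> \<le> C * T * Y powr (1 - 1 / r)"
    proof (cases "T = 0")
      case False
      then have Tp: "T > 0" using T0 by simp
      have "(B' powr (r - 1) * T) powr (1 / r) = B' powr ((r - 1) * (1 / r)) * T powr (1 / r)"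
        using T0 by (simp add: powr_mult powr_powr)
      also have "(r - 1) * (1 / r) = 1 - 1 / r" using r by (simp add: field_simps)
      also have "B' powr (1 - 1 / r) = C powr (1 - 1 / r) * (T powr (1 - 1 / r) * Y powr (1 - 1 / r))"
        using C T0 Y by (simp add: B'_def powr_mult)
      also have "\<dots> * T powr (1 / r) = C powr (1 - 1 / r) * (T powr (1 - 1 / r) * T powr (1 / r)) * Y powr (1 - 1 / r)"
        by (simp only: mult_ac)
      also have "T powr (1 - 1 / r) * T powr (1 / r) = T"
        using Tp unfolding powr_add[symmetric] by simp
      also have "C powr (1 - 1 / r) * T * Y powr (1 - 1 / r) \<le> C powr 1 * T * Y powr (1 - 1 / r)"
        using C T0 q by (intro mult_right_mono powr_mono) auto
      finally show ?thesis using C by simp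
    qed simp
    finally show ?thesis using real r ereal_one_minus_inverse[OF r] by (simp add: Lp_norm_def)
  next
    case PInf
    have "esssup lebesgue (\<lambda>x. ereal (norm (f x))) \<le> ereal (C * T * Y)"
      by (rule esssup_I) (use B in auto)
    moreover have "0 \<le> C * T * Y" using C T0 Y by simp
    ultimately have "real_of_ereal (esssup lebesgue (\<lambda>x. ereal (norm (f x)))) \<le> C * T * Y"
      by (cases "esssup lebesgue (\<lambda>x. ereal (norm (f x)))") auto
    then show ?thesis using PInf Y by (simp add: Lp_norm_def)
  qed (use p in auto)
qed

lemma conv_op_iterate:
  fixes J :: "real ^ 'n \<Rightarrow> real" and u :: "real ^ 'n \<Rightarrow> complex"
  assumes J: "integrable lebesgue J" "\<And>x. 0 \<le> J x" "(LINT x|lebesgue. J x) = 1" and u: "integrable lebesgue u"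
  shows conv_op_iterate_integrable: "integrable lebesgue ((conv_op J ^^ k) u)"
    and conv_op_iterate_norm_le: "(LINT x|lebesgue. norm ((conv_op J ^^ k) u x)) \<le> (LINT x|lebesgue. norm (u x))"
    and fourier_conv_op_iterate: "fourier ((conv_op J ^^ k) u) \<xi> = fourier (\<lambda>x. complex_of_real (J x)) \<xi> ^ k * fourier u \<xi>"
proof (induction k)
  case (Suc k)
  case 1 then show ?case using conv_op_integrable[OF J(1,2) Suc(1)] by simp
  case 2 then show ?case using conv_op_norm_le[OF J(1,2) Suc(1)] Suc(2) J(3) by simp
  case 3 then show ?case using fourier_conv_op[OF J(1,2) Suc(1)] Suc(3) by simp
qed (use u in auto)

lemma AE_bound_of_integrable_fourier_lebesgue:
  fixes f :: "real ^ 'n \<Rightarrow> complex"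
  assumes f: "integrable lebesgue f" and F: "integrable lebesgue (fourier f)"
  shows "AE x in lebesgue. norm (f x) \<le> (LINT \<xi>|lebesgue. norm (fourier f \<xi>)) / (2 * pi) ^ CARD('n)"
proof -
  obtain g where g: "integrable lborel g" "AE x in lborel. f x = g x"
    using borel_representative[OF f] by blast
  have [measurable]: "g \<in> borel_measurable borel"
    using g(1)[THEN borel_measurable_integrable] by simp
  have eq: "fourier f = fourier g" by (rule fourier_cong_AE[OF _ g(2)]) measurable
  have "integrable lborel (fourier g)"
    using F unfolding eq by (subst (asm) integrable_completion) simp_all
  from AE_bound_of_integrable_fourier[OF g(1) this]
  have "AE x in lborel. norm (g x) \<le> (LINT \<xi>|lebesgue. norm (fourier f \<xi>)) / (2 * pi) ^ CARD('n)"
    unfolding eq by (simp add: integral_completion)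
  with g(2) have "AE x in lborel. norm (f x) \<le> (LINT \<xi>|lebesgue. norm (fourier f \<xi>)) / (2 * pi) ^ CARD('n)"
    by eventually_elim simp
  then show ?thesis by (simp add: AE_completion_iff)
qed

lemma fourier_measurable_lebesgue:
  fixes f :: "real ^ 'n \<Rightarrow> complex"
  assumes f: "integrable lebesgue f"
  shows "fourier f \<in> borel_measurable borel"
proof -
  obtain g where g: "integrable lborel g" "AE x in lborel. f x = g x"
    using borel_representative[OF f] by blast
  have "g \<in> borel_measurable borel"
    using g(1)[THEN borel_measurable_integrable] by simp
  then show ?thesis using fourier_cong_AE[OF _ g(2)] fourier_measurable by metis
qed

theorem theorem6:
  fixes J :: "real ^ 'n \<Rightarrow> real" and \<sigma> \<mu> A :: real
  assumes J_radial: "radial J"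
    and J_nonneg: "\<And>x. J x \<ge> 0"
    and J_L1: "J \<in> Lp_space 1"
    and J_norm: "Lp_norm 1 J = 1"
    and \<sigma>: "0 < \<sigma>" "\<sigma> \<le> 2"
    and A: "A > 0"
    and J_expansion:
      "(\<lambda>\<xi>. fourier (\<lambda>x. complex_of_real (J x)) \<xi>
            - (1 - complex_of_real (A * log_gauge \<sigma> \<mu> \<xi>)))
        \<in> o[at 0](\<lambda>\<xi>. complex_of_real (log_gauge \<sigma> \<mu> \<xi>))"
  shows "(\<forall>u0. u0 \<in> Lp_space 1 \<longrightarrow> fourier u0 \<in> Lp_space 1 \<longrightarrow>
            (\<forall>k. \<forall>p\<ge>1. (conv_op J ^^ k) u0 \<in> Lp_space p)) \<and>
         (\<exists>N::nat. N > 0 \<and> (\<exists>C::real. C > 0 \<and>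
            (\<forall>u0. u0 \<in> Lp_space 1 \<longrightarrow> fourier u0 \<in> Lp_space 1 \<longrightarrow>
              (\<forall>p\<ge>1. \<forall>k\<ge>N.
                 Lp_norm p ((conv_op J ^^ k) u0)
                   \<le> C * (Lp_norm 1 u0 + Lp_norm 1 (fourier u0))
                       * (real k * ln (real k) powr \<mu>)
                           powr (- (real CARD('n) / \<sigma>) * real_of_ereal (1 - 1 / p))))))"
proof -
  define \<phi> where "\<phi> = fourier (\<lambda>x. complex_of_real (J x))"
  have J: "integrable lebesgue J" using J_L1 by (simp add: mem_Lp_space_1_iff)
  have J1: "(LINT x|lebesgue. J x) = 1"
    using J_norm J_nonneg by (simp add: Lp_norm_1_eq abs_of_nonneg)
  obtain K where K: "integrable lborel K" "\<And>x. 0 \<le> K x" "AE x in lborel. J x = K x"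
    using borel_representative_real[OF J J_nonneg] by blast
  have Km: "K \<in> borel_measurable borel" using K(1)[THEN borel_measurable_integrable] by simp
  have K1: "(LINT x|lborel. K x) = 1"
    using integral_lebesgue_AE_eq[OF Km K(3)] J1 by simp
  have \<phi>K: "\<phi> = fourier (\<lambda>x. complex_of_real (K x))"
    unfolding \<phi>_def by (rule fourier_cong_AE) (use K(3) Km in auto)
  have \<phi>m: "\<phi> \<in> borel_measurable borel"
    unfolding \<phi>K by (rule fourier_measurable) (use Km in measurable)
  have \<phi>1: "norm (\<phi> \<xi>) \<le> 1" for \<xi>
    using norm_fourier_le[of "\<lambda>x. complex_of_real (J x)" \<xi>] J1 J_nonneg
    by (simp add: \<phi>_def abs_of_nonneg)
  have away: "\<exists>d>0. \<forall>\<xi>. norm \<xi> \<ge> r \<longrightarrow> norm (\<phi> \<xi>) \<le> exp (- d)" if "r > 0" for r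
    unfolding \<phi>K by (rule fourier_bounded_away_from_1[OF K(2,1) K1 that])
  have data: "integrable lebesgue u" "fourier u \<in> borel_measurable borel" "integrable lborel (fourier u)"
      "norm (fourier u \<xi>) \<le> Lp_norm 1 u" "integrable lborel (\<lambda>\<xi>. \<phi> \<xi> ^ k * fourier u \<xi>)"
      "integrable lebesgue ((conv_op J ^^ k) u)"
      "AE x in lebesgue. norm ((conv_op J ^^ k) u x) \<le> (LINT \<xi>|lborel. norm (\<phi> \<xi> ^ k * fourier u \<xi>)) / (2 * pi) ^ CARD('n)"
    if u: "u \<in> Lp_space 1" "fourier u \<in> Lp_space 1" for u :: "real ^ 'n \<Rightarrow> complex" and k \<xi>
  proof -
    show ui: "integrable lebesgue u" using u(1) by (simp add: mem_Lp_space_1_iff)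
    show Fm: "fourier u \<in> borel_measurable borel" by (rule fourier_measurable_lebesgue[OF ui])
    have "integrable lebesgue (fourier u)" using u(2) by (simp add: mem_Lp_space_1_iff)
    then show Fi: "integrable lborel (fourier u)" using Fm by (simp add: integrable_completion)
    show "norm (fourier u \<xi>) \<le> Lp_norm 1 u" unfolding Lp_norm_1_eq by (rule norm_fourier_le)
    show Pi: "integrable lborel (\<lambda>\<xi>. \<phi> \<xi> ^ k * fourier u \<xi>)"
    proof (rule Bochner_Integration.integrable_bound[OF Fi])
      show "AE \<xi> in lborel. norm (\<phi> \<xi> ^ k * fourier u \<xi>) \<le> norm (fourier u \<xi>)"
        by (intro AE_I2) (simp add: norm_mult norm_power mult_left_le_one_le power_le_one \<phi>1)
    qed (use \<phi>m Fm in simp)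
    show ki: "integrable lebesgue ((conv_op J ^^ k) u)"
      by (rule conv_op_iterate_integrable[OF J J_nonneg J1 ui])
    have eq: "fourier ((conv_op J ^^ k) u) = (\<lambda>\<xi>. \<phi> \<xi> ^ k * fourier u \<xi>)"
      unfolding \<phi>_def by (intro ext fourier_conv_op_iterate[OF J J_nonneg J1 ui])
    have Pm: "(\<lambda>\<xi>. \<phi> \<xi> ^ k * fourier u \<xi>) \<in> borel_measurable lborel" using \<phi>m Fm by simp
    have "AE x in lebesgue. norm ((conv_op J ^^ k) u x) \<le> (LINT \<xi>|lebesgue. norm (fourier ((conv_op J ^^ k) u) \<xi>)) / (2 * pi) ^ CARD('n)"
      by (rule AE_bound_of_integrable_fourier_lebesgue[OF ki])
        (use Pi Pm in \<open>simp add: eq integrable_completion\<close>)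
    also have "(LINT \<xi>|lebesgue. norm (fourier ((conv_op J ^^ k) u) \<xi>)) = (LINT \<xi>|lborel. norm (\<phi> \<xi> ^ k * fourier u \<xi>))"
      unfolding eq by (rule integral_completion) (use Pm in measurable)
    finally show "AE x in lebesgue. norm ((conv_op J ^^ k) u x) \<le> (LINT \<xi>|lborel. norm (\<phi> \<xi> ^ k * fourier u \<xi>)) / (2 * pi) ^ CARD('n)" .
  qed
  obtain c where c: "c > 0" and ev: "\<forall>\<^sub>F k in sequentially. \<forall>\<xi>. \<xi> \<noteq> 0 \<longrightarrow>
     norm (\<phi> \<xi>) ^ k \<le> exp c * exp (- c * norm (rate \<mu> k powr (1 / \<sigma>) *\<^sub>R \<xi>) powr (\<sigma> / 2))
       + rate \<mu> k powr - (real CARD('n) / \<sigma>)"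
    using symbol_power_bound[OF \<sigma>(1) A J_expansion[folded \<phi>_def] \<phi>1 away] by blast
  then obtain N0 where N0: "\<And>k \<xi>. k \<ge> N0 \<Longrightarrow> \<xi> \<noteq> 0 \<Longrightarrow>
     norm (\<phi> \<xi>) ^ k \<le> exp c * exp (- c * norm (rate \<mu> k powr (1 / \<sigma>) *\<^sub>R \<xi>) powr (\<sigma> / 2))
       + rate \<mu> k powr - (real CARD('n) / \<sigma>)"
    unfolding eventually_sequentially by blast
  define I where "I = (LINT \<eta>|lborel. exp (- c * norm (\<eta> :: real ^ 'n) powr (\<sigma> / 2)))"
  have I0: "0 \<le> I" unfolding I_def by (intro integral_nonneg_AE) simp
  \<comment> \<open>From $k = 2$ on, $\ln k > 0$ and the rate is positive.\<close>
  define N where "N = max 2 N0"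
  \<comment> \<open>The lower bound one covers the coefficient of $\|\widehat u_0\|_{L^1}$, and interpolation needs it.\<close>
  define C where "C = max 1 (exp c * I)"
  have C1: "1 \<le> C" "exp c * I \<le> C" by (auto simp: C_def)
  have part1: "(conv_op J ^^ k) u \<in> Lp_space p" if "u \<in> Lp_space 1" "fourier u \<in> Lp_space 1" "1 \<le> p" for u k p
    by (rule bounded_L1_in_Lp[OF data(6,7)[OF that(1,2)] that(3)])
  have part2: "Lp_norm p ((conv_op J ^^ k) u) \<le> C * (Lp_norm 1 u + Lp_norm 1 (fourier u))
      * (real k * ln (real k) powr \<mu>) powr (- (real CARD('n) / \<sigma>) * real_of_ereal (1 - 1 / p))"
    if u: "u \<in> Lp_space 1" "fourier u \<in> Lp_space 1" and p: "1 \<le> p" and k: "k \<ge> N" for u k p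
  proof -
    define T where "T = Lp_norm 1 u + Lp_norm 1 (fourier u)"
    define Y where "Y = rate \<mu> k powr - (real CARD('n) / \<sigma>)"
    have X: "rate \<mu> k > 0" using k by (intro rate_pos) (simp add: N_def)
    have Y: "Y > 0" using X by (simp add: Y_def)
    have nn: "0 \<le> Lp_norm 1 u" "0 \<le> Lp_norm 1 (fourier u)" by (simp_all add: Lp_norm_1_eq)
    have "(LINT \<xi>|lborel. norm (fourier u \<xi>)) = Lp_norm 1 (fourier u)"
      unfolding Lp_norm_1_eq by (rule integral_completion[symmetric]) (use data(2)[OF u] in measurable)
    then have "(LINT \<xi>|lborel. norm (\<phi> \<xi> ^ k * fourier u \<xi>)) \<le> (exp c * I * Lp_norm 1 u + Lp_norm 1 (fourier u)) * Y"
      unfolding I_def Y_def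
      using integral_symbol_power_bound[OF c \<sigma>(1) X N0 data(3)[OF u] data(4)[OF u] data(5)[OF u]] k
      by (simp add: N_def)
    also have "\<dots> \<le> (C * Lp_norm 1 u + C * Lp_norm 1 (fourier u)) * Y"
      using C1 nn Y mult_right_mono[of 1 C "Lp_norm 1 (fourier u)"]
      by (intro mult_right_mono add_mono) auto
    also have "\<dots> = C * T * Y" by (simp add: T_def ring_distribs)
    finally have le: "(LINT \<xi>|lborel. norm (\<phi> \<xi> ^ k * fourier u \<xi>)) \<le> C * T * Y" .
    have "1 \<le> 2 * pi" using pi_gt3 by simp
    then have "1 \<le> (2 * pi) ^ CARD('n)" by (rule one_le_power)
    then have "(LINT \<xi>|lborel. norm (\<phi> \<xi> ^ k * fourier u \<xi>)) / (2 * pi) ^ CARD('n) \<le> (LINT \<xi>|lborel. norm (\<phi> \<xi> ^ k * fourier u \<xi>)) / 1"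
      by (intro divide_left_mono) auto
    with le have "(LINT \<xi>|lborel. norm (\<phi> \<xi> ^ k * fourier u \<xi>)) / (2 * pi) ^ CARD('n) \<le> C * T * Y" by simp
    with data(7)[OF u, of k] have B: "AE x in lebesgue. norm ((conv_op J ^^ k) u x) \<le> C * T * Y"
      by (auto elim: eventually_mono)
    have L: "(LINT x|lebesgue. norm ((conv_op J ^^ k) u x)) \<le> T"
      using conv_op_iterate_norm_le[OF J J_nonneg J1 data(1)[OF u], of k] nn
      unfolding T_def Lp_norm_1_eq by linarith
    have "Lp_norm p ((conv_op J ^^ k) u) \<le> C * T * Y powr real_of_ereal (1 - 1 / p)"
      by (rule Lp_norm_interpolation[OF data(6)[OF u] L B C1(1) Y p])
    then show ?thesis by (simp add: T_def Y_def rate_def powr_powr)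
  qed
  show ?thesis
  proof (intro conjI exI[of _ N] exI[of _ C] allI impI)
    show "0 < N" "0 < C" using C1(1) by (auto simp: N_def)
  qed (use part1 part2 in blast)+
qed

end
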